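(* Let $X:f=0$ be a surface of degree $d$ in $\mathbb{P}^3$ over $\mathbb{C}$ with at most isolated singularities, with exponents $d_1\le d_2\le d_3\le\dots\le d_p$. Then $$t(X)=d_1+d_2+d_3+1-d\ \ge\ d_3\ \ge\ \frac{d-1}{2}.$$ In particular, if $d>1$, such a surface is not free.
   Context: $S=\mathbb{C}[x,y,z,t]$ with its standard grading; $f\in S$ is homogeneous of degree $d$. $AR(f)=\{(a^x,a^y,a^z,a^t)\in S^4: a^xf_x+a^yf_y+a^zf_z+a^tf_t=0\}$ is the graded $S$-module of Jacobian syzygies of $f$, where a homogeneous syzygy has degree $e$ if its components are homogeneous of degree $e$. The exponents $d_1\le d_2\le\dots\le d_p$ ($p\ge 3$) of $X$ are the degrees of the elements of a minimal set of homogeneous generators of $AR(f)$. The type of $X$ is $t(X)=d_1+d_2+d_3-d+1$. The surface $X$ is free if $AR(f)$ is a free $S$-module. "At most isolated singularities" means that the singular subscheme of $X$ defined by the Jacobian ideal $(f_x,f_y,f_z,f_t)$ is finite or empty. *)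

theory Defs
  imports "HOL-Analysis.Analysis" "HOL-Library.Poly_Mapping"
begin

text \<open>
  The ring \<open>S = \<complex>[x,y,z,t]\<close>: finitely supported functions from exponent vectors to coefficients,
  with the convolution product. The four elements of the numeral type \<open>4\<close> index the variables.
\<close>

type_synonym S = "(4 \<Rightarrow>\<^sub>0 nat) \<Rightarrow>\<^sub>0 complex"

definition mdeg :: "(4 \<Rightarrow>\<^sub>0 nat) \<Rightarrow> nat" where
  "mdeg m = (\<Sum>i\<in>UNIV. Poly_Mapping.lookup m i)"

text \<open>As usual, the zero polynomial is homogeneous of every degree.\<close>

definition homogeneous :: "nat \<Rightarrow> S \<Rightarrow> bool" where
  "homogeneous e g \<longleftrightarrow> (\<forall>m\<in>Poly_Mapping.keys g. mdeg m = e)"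

text \<open>
  The subtraction of exponents is truncated, which is harmless: if the variable \<open>i\<close> does not occur
  in the monomial \<open>m\<close>, then the coefficient vanishes.
\<close>

definition pd :: "4 \<Rightarrow> S \<Rightarrow> S" where
  "pd i g = (\<Sum>m\<in>Poly_Mapping.keys g. Poly_Mapping.single (m - Poly_Mapping.single i 1)
                              (of_nat (Poly_Mapping.lookup m i) * Poly_Mapping.lookup g m))"

definition eval_at :: "complex ^ 4 \<Rightarrow> S \<Rightarrow> complex" where
  "eval_at p g = (\<Sum>m\<in>Poly_Mapping.keys g. Poly_Mapping.lookup g m * (\<Prod>i\<in>UNIV. (p $ i) ^ Poly_Mapping.lookup m i))"

text \<open>
  A point of \<open>\<P>\<^sup>3\<close> is a line through the origin in \<open>\<complex>\<^sup>4\<close>. The singular subscheme is of finite type over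
  \<open>\<complex>\<close>, so it is finite (or empty) exactly when it has finitely many (or no) closed points, that is,
  when the Jacobian ideal has finitely many zeros in \<open>\<P>\<^sup>3(\<complex>)\<close>.
\<close>

definition singular_points :: "S \<Rightarrow> (complex ^ 4) set set" where
  "singular_points f = {vec.span {p} | p. p \<noteq> 0 \<and> (\<forall>i. eval_at p (pd i f) = 0)}"

definition at_most_isolated_singularities :: "S \<Rightarrow> bool" where
  "at_most_isolated_singularities f \<longleftrightarrow> finite (singular_points f)"

interpretation S4: module "(*s) :: S \<Rightarrow> S ^ 4 \<Rightarrow> S ^ 4"
  by unfold_locales (simp_all add: vec_eq_iff algebra_simps)

definition AR :: "S \<Rightarrow> (S ^ 4) set" where
  "AR f = {a. (\<Sum>i\<in>UNIV. a $ i * pd i f) = 0}"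

lemma subspace_AR: "S4.subspace (AR f)"
  by (auto simp: S4.subspace_def AR_def algebra_simps sum.distrib simp flip: sum_distrib_left)

definition homogeneous_vec :: "nat \<Rightarrow> S ^ 4 \<Rightarrow> bool" where
  "homogeneous_vec e a \<longleftrightarrow> (\<forall>i. homogeneous e (a $ i))"

definition minimal_generating_set :: "(S ^ 4) set \<Rightarrow> (S ^ 4) set \<Rightarrow> bool" where
  "minimal_generating_set M R \<longleftrightarrow> S4.span R = M \<and> (\<forall>R'. R' \<subset> R \<longrightarrow> S4.span R' \<noteq> M)"

text \<open>
  \<open>exponents f ds\<close>: the list \<open>ds\<close> is \<open>d\<^sub>1 \<le> \<dots> \<le> d\<^sub>p\<close>, so that \<open>d\<^sub>k = ds ! (k - 1)\<close>. A minimal generating set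
  does not contain \<open>0\<close>, so the degree of each generator is unique.
\<close>

definition exponents :: "S \<Rightarrow> nat list \<Rightarrow> bool" where
  "exponents f ds \<longleftrightarrow> sorted ds \<and>
     (\<exists>rs. distinct rs \<and> minimal_generating_set (AR f) (set rs) \<and> list_all2 homogeneous_vec ds rs)"

definition surface_type :: "nat \<Rightarrow> nat list \<Rightarrow> int" where
  "surface_type d ds = int (ds ! 0) + int (ds ! 1) + int (ds ! 2) - int d + 1"

definition free_module :: "(S ^ 4) set \<Rightarrow> bool" where
  "free_module M \<longleftrightarrow> (\<exists>B. S4.independent B \<and> S4.span B = M)"

definition free_surface :: "S \<Rightarrow> bool" where
  "free_surface f \<longleftrightarrow> free_module (AR f)"

end

(*
  Let F be the four partial derivatives, forms of degree n = d - 1. A plane l = 0 that misses the singular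
  points meets the zero set of F only at the origin, so by the Nullstellensatz the ideal (F, l) contains a
  power of every variable. Hence (F) contains three forms X, Y, Z that restrict to powers of the coordinates
  on this plane, and these form a regular sequence: the Jacobian ideal has depth 3.

  By depth 3 the complex given by multiplication with F on the exterior algebra of S^4 is exact up to
  degree 2. If a, b are syzygies of degrees k, m, then the dual of a /\ b is a 2-form killed by F, so it is
  a multiple of F, and a /\ b vanishes when k + m < n. By unique factorisation a and b are then multiples
  of a single syzygy c; if a has the lowest degree among the generators, then c, and so b, is a multiple
  of a, contradicting minimality. Thus d_1 + d_2 >= d - 1.

  If the module of syzygies were free, then X, Y, Z would also be a regular sequence on it. Writing
  X = a F, Y = b F, Z = c F, the syzygies X b - Y a, Y c - Z b, Z a - X c satisfy a linear relation with
  coefficients Z, X, Y, and resolving it inside the module gives e with e F = 1, which is absurd for n > 0.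
*)

theory Submission
  imports Defs "HOL-Computational_Algebra.Field_as_Ring" "HOL-Computational_Algebra.Polynomial_Factorial"
    "HOL-Computational_Algebra.Fundamental_Theorem_Algebra"
begin

subsection \<open>Polynomials in four variables\<close>

abbreviation Const :: "complex \<Rightarrow> S" where
  "Const \<equiv> Poly_Mapping.single 0"

definition var :: "4 \<Rightarrow> S" where
  "var i = Poly_Mapping.single (Poly_Mapping.single i 1) 1"

lemma poly_mapping_eq_sum_single:
  "(\<Sum>m\<in>Poly_Mapping.keys g. Poly_Mapping.single m (Poly_Mapping.lookup g m)) = g"
  by (rule poly_mapping_eqI)
     (auto simp: lookup_sum lookup_single when_def in_keys_iff if_distrib cong: if_cong)

lemma S_induct_single [case_names single add]:
  fixes g :: S
  assumes s: "\<And>m c. P (Poly_Mapping.single m c)" and a: "\<And>g h. P g \<Longrightarrow> P h \<Longrightarrow> P (g + h)"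
  shows "P g"
proof -
  have z: "P 0" using s[of 0 0] by simp
  have "P (\<Sum>m\<in>A. Poly_Mapping.single m (Poly_Mapping.lookup g m))" if "finite A" for A
    using that by (induction A) (auto simp: z intro: s a)
  from this[of "Poly_Mapping.keys g"] show ?thesis
    by (simp add: poly_mapping_eq_sum_single)
qed

lemma var_power: "var i ^ n = Poly_Mapping.single (Poly_Mapping.single i n) 1"
  by (induction n) (simp_all add: var_def mult_single single_add[symmetric])

lemma single_eq_prod:
  "Poly_Mapping.single m c = Const c * (\<Prod>i\<in>UNIV. var i ^ Poly_Mapping.lookup m i)"
proof -
  have "(\<Prod>i\<in>A. var i ^ Poly_Mapping.lookup m i)
      = Poly_Mapping.single (\<Sum>i\<in>A. Poly_Mapping.single i (Poly_Mapping.lookup m i)) 1" if "finite A" for A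
    using that by (induction A) (auto simp: var_power mult_single)
  moreover have "(\<Sum>i\<in>UNIV. Poly_Mapping.single i (Poly_Mapping.lookup m i)) = m"
    by (rule poly_mapping_eqI)
       (simp add: lookup_sum lookup_single when_def if_distrib cong: if_cong)
  ultimately show ?thesis by (simp add: mult_single)
qed

lemma S_induct [case_names Const var add mult]:
  fixes g :: S
  assumes c: "\<And>c. P (Const c)" and v: "\<And>i. P (var i)"
    and a: "\<And>g h. P g \<Longrightarrow> P h \<Longrightarrow> P (g + h)" and m: "\<And>g h. P g \<Longrightarrow> P h \<Longrightarrow> P (g * h)"
  shows "P g"
proof (induction g rule: S_induct_single)
  case (single m c)
  have one: "P 1" using c[of 1] by simp
  have pw: "P (var i ^ n)" for i n
    by (induction n) (auto intro: v m one)
  have "P (\<Prod>i\<in>A. var i ^ Poly_Mapping.lookup m i)" if "finite A" for A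
    using that by (induction A) (auto intro: m one pw)
  then show ?case by (subst single_eq_prod) (auto intro: m c)
qed (rule a)

section \<open>Ring homomorphisms and substitution\<close>

definition ring_map :: "('a::comm_ring_1 \<Rightarrow> 'b::comm_ring_1) \<Rightarrow> bool" where
  "ring_map h \<longleftrightarrow> h 0 = 0 \<and> h 1 = 1 \<and> (\<forall>x y. h (x + y) = h x + h y) \<and> (\<forall>x y. h (x * y) = h x * h y)"

lemma ring_mapD:
  assumes "ring_map h"
  shows "h 0 = 0" "h 1 = 1" "h (x + y) = h x + h y" "h (x * y) = h x * h y"
    "h (- x) = - h x" "h (x - y) = h x - h y" "h (x ^ n) = h x ^ n" "h (sum g A) = (\<Sum>i\<in>A. h (g i))"
proof -
  show z: "h 0 = 0" and o: "h 1 = 1" and a: "h (x + y) = h x + h y" and m: "h (x * y) = h x * h y" for x y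
    using assms by (auto simp: ring_map_def)
  show n: "h (- x) = - h x" for x
    using a[of x "- x"] z by (simp add: eq_neg_iff_add_eq_0 add.commute)
  show "h (x - y) = h x - h y" using a[of x "- y"] n[of y] by simp
  show "h (x ^ n) = h x ^ n" by (induction n) (auto simp: o m)
  show "h (sum g A) = (\<Sum>i\<in>A. h (g i))"
    by (induction A rule: infinite_finite_induct) (auto simp: z a)
qed

lemma ring_map_comp: "ring_map g \<Longrightarrow> ring_map h \<Longrightarrow> ring_map (\<lambda>x. g (h x))"
  by (simp add: ring_map_def)

lemma ring_map_Const: "ring_map Const"
  by (simp add: ring_map_def single_add mult_single)

lemma ring_map_S_eqI:
  fixes h k :: "S \<Rightarrow> 'a::comm_ring_1"
  assumes "ring_map h" "ring_map k" "\<And>c. h (Const c) = k (Const c)" "\<And>i. h (var i) = k (var i)"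
  shows "h g = k g"
  by (induction g rule: S_induct) (auto simp: assms ring_mapD[OF assms(1)] ring_mapD[OF assms(2)])

text \<open>The map given by the universal property of \<open>S\<close>: \<open>c\<close> acts on
  the coefficients and \<open>p\<close> gives the images of the variables. Evaluation at a point,
  restriction to a plane and the passage to iterated polynomials are all instances.\<close>

definition subst :: "(complex \<Rightarrow> 'a::comm_ring_1) \<Rightarrow> (4 \<Rightarrow> 'a) \<Rightarrow> S \<Rightarrow> 'a" where
  "subst c p g = (\<Sum>m\<in>Poly_Mapping.keys g. c (Poly_Mapping.lookup g m) * (\<Prod>i\<in>UNIV. p i ^ Poly_Mapping.lookup m i))"

context
  fixes c :: "complex \<Rightarrow> 'a::comm_ring_1" and p :: "4 \<Rightarrow> 'a"
  assumes c: "ring_map c"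
begin

lemma subst_superset:
  assumes "finite A" "Poly_Mapping.keys g \<subseteq> A"
  shows "subst c p g = (\<Sum>m\<in>A. c (Poly_Mapping.lookup g m) * (\<Prod>i\<in>UNIV. p i ^ Poly_Mapping.lookup m i))"
  unfolding subst_def using assms
  by (intro sum.mono_neutral_left) (auto simp: in_keys_iff ring_mapD[OF c])

lemma subst_single: "subst c p (Poly_Mapping.single m a) = c a * (\<Prod>i\<in>UNIV. p i ^ Poly_Mapping.lookup m i)"
  by (subst subst_superset[of "{m}"]) (auto simp: lookup_single)

lemma subst_add: "subst c p (g + h) = subst c p g + subst c p h"
proof -
  let ?A = "Poly_Mapping.keys g \<union> Poly_Mapping.keys h"
  have "Poly_Mapping.keys (g + h) \<subseteq> ?A" by (rule keys_add)
  then show ?thesis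
    by (simp add: subst_superset[of ?A] lookup_add ring_mapD[OF c] sum.distrib algebra_simps)
qed

lemma subst_mult: "subst c p (g * h) = subst c p g * subst c p h"
proof (induction g rule: S_induct_single)
  case (single m a)
  show ?case
    by (induction h rule: S_induct_single)
       (simp_all add: mult_single subst_single lookup_add power_add prod.distrib ring_mapD[OF c] subst_add algebra_simps)
qed (simp add: subst_add algebra_simps)

lemma subst_Const: "subst c p (Const a) = c a"
  by (simp add: subst_single)

lemma subst_var: "subst c p (var i) = p i"
proof -

  have "(\<Prod>j\<in>UNIV. p j ^ Poly_Mapping.lookup (Poly_Mapping.single i 1) j) = (\<Prod>j\<in>{i}. p j)"
    by (intro prod.mono_neutral_cong_right) (auto simp: lookup_single when_def)
  then show ?thesis by (simp add: var_def subst_single ring_mapD[OF c])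
qed

lemma ring_map_subst: "ring_map (subst c p)"
  using subst_Const[of 0] subst_Const[of 1]
  by (simp add: ring_map_def subst_add subst_mult ring_mapD[OF c])

end

lemma ring_map_id: "ring_map (\<lambda>x. x)"
  by (simp add: ring_map_def)

lemma eval_at_eq_subst: "eval_at p = subst (\<lambda>x. x) (\<lambda>i. p $ i)"
  by (rule ext) (simp add: eval_at_def subst_def)

lemma ring_map_eval_at: "ring_map (eval_at p)"
  unfolding eval_at_eq_subst by (rule ring_map_subst[OF ring_map_id])

lemma eval_at_Const [simp]: "eval_at p (Const a) = a"
  by (simp add: eval_at_eq_subst subst_Const[OF ring_map_id])

lemma eval_at_var [simp]: "eval_at p (var i) = p $ i"
  unfolding eval_at_eq_subst by (rule subst_var[OF ring_map_id])

section \<open>Homogeneous components\<close>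

definition hom_part :: "nat \<Rightarrow> S \<Rightarrow> S" where
  "hom_part k g = (\<Sum>m\<in>{m\<in>Poly_Mapping.keys g. mdeg m = k}. Poly_Mapping.single m (Poly_Mapping.lookup g m))"

lemma lookup_hom_part: "Poly_Mapping.lookup (hom_part k g) m = (if mdeg m = k then Poly_Mapping.lookup g m else 0)"
proof -
  have "(\<Sum>x\<in>{m\<in>Poly_Mapping.keys g. mdeg m = k}. if x = m then Poly_Mapping.lookup g x else 0)
    = (if mdeg m = k then Poly_Mapping.lookup g m else 0)"
    by (subst sum.delta) (auto simp: in_keys_iff)
  then show ?thesis
    by (simp add: hom_part_def lookup_sum lookup_single when_def)
qed

lemma hom_part_add: "hom_part k (g + h) = hom_part k g + hom_part k h"
  and hom_part_diff: "hom_part k (g - h) = hom_part k g - hom_part k h"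
  and hom_part_zero [simp]: "hom_part k 0 = 0"
  by (rule poly_mapping_eqI; simp add: lookup_hom_part lookup_add lookup_minus)+

lemma hom_part_sum: "hom_part k (sum g A) = (\<Sum>i\<in>A. hom_part k (g i))"
  by (induction A rule: infinite_finite_induct) (simp_all add: hom_part_add)

lemma homogeneous_hom_part: "homogeneous k (hom_part k g)"
  by (auto simp: homogeneous_def in_keys_iff lookup_hom_part split: if_splits)

lemma hom_part_homogeneous: "homogeneous e g \<Longrightarrow> hom_part k g = (if k = e then g else 0)"
  by (rule poly_mapping_eqI) (auto simp: homogeneous_def in_keys_iff lookup_hom_part)

lemma hom_part_single: "hom_part k (Poly_Mapping.single m a) = (if mdeg m = k then Poly_Mapping.single m a else 0)"
  by (rule poly_mapping_eqI) (auto simp: lookup_hom_part lookup_single when_def)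

lemma mdeg_add: "mdeg (m + m') = mdeg m + mdeg m'"
  by (simp add: mdeg_def lookup_add sum.distrib)

lemma mdeg_zero [simp]: "mdeg 0 = 0"
  by (simp add: mdeg_def)

lemma mdeg_single [simp]: "mdeg (Poly_Mapping.single i n) = n"
  by (simp add: mdeg_def lookup_single when_def if_distrib cong: if_cong)

lemma homogeneous_mult: "homogeneous a g \<Longrightarrow> homogeneous b h \<Longrightarrow> homogeneous (a + b) (g * h)"
  using keys_mult[of g h] unfolding homogeneous_def by (auto simp: mdeg_add)

lemma homogeneous_zero [simp]: "homogeneous k 0"
  by (simp add: homogeneous_def)

lemma homogeneous_add: "homogeneous a g \<Longrightarrow> homogeneous a h \<Longrightarrow> homogeneous a (g + h)"
  using keys_add[of g h] unfolding homogeneous_def by auto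

lemma homogeneous_diff: "homogeneous a g \<Longrightarrow> homogeneous a h \<Longrightarrow> homogeneous a (g - h)"
  by (metis hom_part_diff hom_part_homogeneous homogeneous_hom_part)

lemma homogeneous_Const [simp]: "homogeneous 0 (Const c)"
  by (simp add: homogeneous_def)

lemma homogeneous_one [simp]: "homogeneous 0 1"
  by (simp add: homogeneous_def)

lemma homogeneous_var [simp]: "homogeneous 1 (var i)"
  by (simp add: var_def homogeneous_def)

lemma homogeneous_power: "homogeneous e g \<Longrightarrow> homogeneous (n * e) (g ^ n)"
  by (induction n) (auto intro: homogeneous_mult)

lemma hom_part_mult: "hom_part k (g * h) = (\<Sum>i\<le>k. hom_part i g * hom_part (k - i) h)"
proof (induction g rule: S_induct_single)
  case (single m a)
  show ?case
  proof (induction h rule: S_induct_single)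
    case (single m' b)
    have "(\<Sum>i\<le>k. hom_part i (Poly_Mapping.single m a) * hom_part (k - i) (Poly_Mapping.single m' b))
      = (\<Sum>i\<le>k. if i = mdeg m then hom_part i (Poly_Mapping.single m a) * hom_part (k - i) (Poly_Mapping.single m' b) else 0)"
      by (intro sum.cong) (auto simp: hom_part_single)
    also have "\<dots> = hom_part k (Poly_Mapping.single m a * Poly_Mapping.single m' b)"
      by (auto simp: hom_part_single mult_single mdeg_add)
    finally show ?case ..
  qed (simp add: hom_part_add algebra_simps sum.distrib)
qed (simp add: hom_part_add algebra_simps sum.distrib)

text \<open>The case \<open>k < e\<close> drives the degree arguments below: a multiple of a form
  has no components below the degree of that form.\<close>

lemma hom_part_mult_homogeneous:
  assumes "homogeneous e g"
  shows "hom_part k (g * h) = (if e \<le> k then g * hom_part (k - e) h else 0)"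
proof -
  have "hom_part k (g * h) = (\<Sum>i\<le>k. if i = e then g * hom_part (k - i) h else 0)"
    unfolding hom_part_mult by (intro sum.cong) (auto simp: hom_part_homogeneous[OF assms])
  then show ?thesis by simp
qed

lemma hom_part_eventually_zero: obtains D where "\<And>k. k > D \<Longrightarrow> hom_part k g = 0"
proof
  fix k assume "k > Max (insert 0 (mdeg ` Poly_Mapping.keys g))"
  then have "\<forall>m\<in>Poly_Mapping.keys g. mdeg m \<noteq> k" by (auto simp: Max_less_iff)
  then show "hom_part k g = 0"
    by (intro poly_mapping_eqI) (auto simp: lookup_hom_part in_keys_iff)
qed

lemma sum_hom_part: obtains D where "g = (\<Sum>k\<le>D. hom_part k g)"
proof -
  obtain D where D: "\<And>k. k > D \<Longrightarrow> hom_part k g = 0" using hom_part_eventually_zero by blast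
  have "g = (\<Sum>k\<le>D. hom_part k g)"
  proof (rule poly_mapping_eqI)
    fix m show "Poly_Mapping.lookup g m = Poly_Mapping.lookup (\<Sum>k\<le>D. hom_part k g) m"
      using D[of "mdeg m"] lookup_hom_part[of "mdeg m" g m]
      by (cases "mdeg m \<le> D") (auto simp: lookup_sum lookup_hom_part)
  qed
  then show thesis by (rule that)
qed

section \<open>Partial derivatives\<close>

lemma lookup_pd: "Poly_Mapping.lookup (pd i g) m
    = of_nat (Poly_Mapping.lookup m i + 1) * Poly_Mapping.lookup g (m + Poly_Mapping.single i 1)"
proof -
  let ?e = "Poly_Mapping.single i (1::nat)"
  \<comment> \<open>Truncated subtraction is not injective on monomials. It becomes so once the
    variable \<open>i\<close> is required to occur, and the terms without it carry the factor
    0.\<close>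
  have eq: "(m' - ?e = m \<and> Poly_Mapping.lookup m' i \<noteq> 0) \<longleftrightarrow> m' = m + ?e" for m' :: "4 \<Rightarrow>\<^sub>0 nat"
    by (auto simp: poly_mapping_eq_iff lookup_add lookup_minus lookup_single when_def fun_eq_iff)
  have "Poly_Mapping.lookup (pd i g) m = (\<Sum>m'\<in>Poly_Mapping.keys g.
      if m' = m + ?e then of_nat (Poly_Mapping.lookup m' i) * Poly_Mapping.lookup g m' else 0)"
    unfolding pd_def lookup_sum
  proof (rule sum.cong[OF refl])
    fix m'
    show "Poly_Mapping.lookup (Poly_Mapping.single (m' - ?e) (of_nat (Poly_Mapping.lookup m' i) * Poly_Mapping.lookup g m')) m
      = (if m' = m + ?e then of_nat (Poly_Mapping.lookup m' i) * Poly_Mapping.lookup g m' else 0)"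
      using eq[of m'] by (auto simp: lookup_single when_def)
  qed
  also have "\<dots> = of_nat (Poly_Mapping.lookup m i + 1) * Poly_Mapping.lookup g (m + ?e)"
    by (auto simp: in_keys_iff lookup_add)
  finally show ?thesis .
qed

lemma homogeneous_pd:
  assumes "homogeneous d f" shows "homogeneous (d - 1) (pd i f)"
proof -
  have "mdeg m = d - 1" if "Poly_Mapping.lookup f (m + Poly_Mapping.single i 1) \<noteq> 0" for m
    using assms that by (force simp: homogeneous_def in_keys_iff mdeg_add)
  then show ?thesis by (auto simp: homogeneous_def in_keys_iff lookup_pd)
qed

text \<open>A monomial of positive degree contains some variable \<open>i\<close>, and in
  characteristic 0 its term survives differentiation with respect to \<open>i\<close>.\<close>

lemma pd_nonzero:
  assumes "homogeneous d f" "f \<noteq> 0" "d \<ge> 1"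
  obtains i where "pd i f \<noteq> 0"
proof -
  obtain m where m: "m \<in> Poly_Mapping.keys f" using assms(2) by (metis ex_in_conv keys_eq_empty)
  then have "(\<Sum>i\<in>UNIV. Poly_Mapping.lookup m i) \<noteq> 0" using assms by (auto simp: homogeneous_def mdeg_def)
  then obtain i where i: "Poly_Mapping.lookup m i \<noteq> 0" by (metis sum.neutral)
  have "m = (m - Poly_Mapping.single i 1) + Poly_Mapping.single i 1"
    using i by (auto simp: poly_mapping_eq_iff lookup_add lookup_minus lookup_single when_def fun_eq_iff)
  then have "Poly_Mapping.lookup (pd i f) (m - Poly_Mapping.single i 1) \<noteq> 0"
    using m by (simp add: lookup_pd in_keys_iff del: of_nat_Suc)
  then show thesis using that by force
qed

subsection \<open>Lifting regular sequences from a hyperplane\<close>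

lemma lookup_var_power_mult:
  "Poly_Mapping.lookup (var i ^ N * g) (Poly_Mapping.single i N + m) = Poly_Mapping.lookup g m"
proof (induction g rule: S_induct_single)
  case (single m' c)
  then show ?case by (simp add: var_power mult_single lookup_single when_def)
qed (simp add: lookup_add algebra_simps)

lemma keys_var_power_mult:
  assumes "m \<in> Poly_Mapping.keys (var i ^ N * g)" shows "N \<le> Poly_Mapping.lookup m i"
proof -
  have "Poly_Mapping.keys (var i ^ N * g) \<subseteq> {a + b |a b. a \<in> Poly_Mapping.keys (var i ^ N) \<and> b \<in> Poly_Mapping.keys g}"
    by (rule keys_mult)
  then show ?thesis using assms by (auto simp: var_power lookup_add)
qed

lemma var_power_dvd_sum_single:
  assumes "\<And>m. m \<in> A \<Longrightarrow> N \<le> Poly_Mapping.lookup m i"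
  shows "var i ^ N dvd (\<Sum>m\<in>A. Poly_Mapping.single m (c m))"
proof (rule dvd_sum)
  fix m assume "m \<in> A"
  then have "m = Poly_Mapping.single i N + (m - Poly_Mapping.single i N)"
    using assms[of m]
    by (auto simp: poly_mapping_eq_iff lookup_add lookup_minus lookup_single when_def fun_eq_iff)
  then have "Poly_Mapping.single m (c m) = var i ^ N * Poly_Mapping.single (m - Poly_Mapping.single i N) (c m)"
    by (simp add: var_power mult_single)
  then show "var i ^ N dvd Poly_Mapping.single m (c m)" by simp
qed

lemma var_power_dvd_iff:
  "var i ^ N dvd g \<longleftrightarrow> (\<forall>m\<in>Poly_Mapping.keys g. N \<le> Poly_Mapping.lookup m i)"
proof
  assume "var i ^ N dvd g"
  then show "\<forall>m\<in>Poly_Mapping.keys g. N \<le> Poly_Mapping.lookup m i"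
    by (elim dvdE) (simp add: keys_var_power_mult)
next
  assume "\<forall>m\<in>Poly_Mapping.keys g. N \<le> Poly_Mapping.lookup m i"
  then show "var i ^ N dvd g"
    using var_power_dvd_sum_single[of "Poly_Mapping.keys g" N i "Poly_Mapping.lookup g"]
    by (simp add: poly_mapping_eq_sum_single)
qed

lemma keys_var_power_mult_shift:
  "m \<in> Poly_Mapping.keys g \<Longrightarrow> Poly_Mapping.single i N + m \<in> Poly_Mapping.keys (var i ^ N * g)"
  by (simp add: in_keys_iff lookup_var_power_mult)

text \<open>Multiplication by \<open>var j ^ N\<close> leaves the exponents of \<open>i\<close>
  alone, so it is injective modulo \<open>var i ^ N\<close>.\<close>

lemma var_power_dvd_cancel:
  assumes "i \<noteq> j" "var i ^ N dvd var j ^ N * B" shows "var i ^ N dvd B"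
  unfolding var_power_dvd_iff
proof
  fix m assume "m \<in> Poly_Mapping.keys B"
  then have "N \<le> Poly_Mapping.lookup (Poly_Mapping.single j N + m) i"
    using assms(2) keys_var_power_mult_shift[of m B j N] by (simp add: var_power_dvd_iff)
  then show "N \<le> Poly_Mapping.lookup m i"
    using assms(1) by (simp add: lookup_add lookup_single)
qed

text \<open>A polynomial lies in a monomial ideal exactly when all its monomials do, and
  multiplication by \<open>var k ^ N\<close> changes the exponents of neither \<open>i\<close> nor
  \<open>j\<close>.\<close>

lemma var_power_regular:
  assumes "i \<noteq> k" "j \<noteq> k" "var k ^ N * C = var i ^ N * a + var j ^ N * b"
  obtains \<alpha> \<beta> where "C = var i ^ N * \<alpha> + var j ^ N * \<beta>"
proof -
  let ?K = "Poly_Mapping.keys C"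
  let ?A = "{m\<in>?K. N \<le> Poly_Mapping.lookup m i}"
  have *: "N \<le> Poly_Mapping.lookup m i \<or> N \<le> Poly_Mapping.lookup m j" if "m \<in> ?K" for m
  proof -
    have "Poly_Mapping.single k N + m \<in> Poly_Mapping.keys (var i ^ N * a) \<union> Poly_Mapping.keys (var j ^ N * b)"
      using keys_var_power_mult_shift[OF that, of k N] keys_add[of "var i ^ N * a" "var j ^ N * b"]
      unfolding assms(3) by (rule rev_subsetD)
    then have "N \<le> Poly_Mapping.lookup (Poly_Mapping.single k N + m) i
        \<or> N \<le> Poly_Mapping.lookup (Poly_Mapping.single k N + m) j"
      using keys_var_power_mult by (elim UnE) blast+
    then show ?thesis using assms(1,2) by (simp add: lookup_add lookup_single)
  qed
  let ?t = "\<lambda>m. Poly_Mapping.single m (Poly_Mapping.lookup C m)"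
  have "var i ^ N dvd (\<Sum>m\<in>?A. ?t m)" "var j ^ N dvd (\<Sum>m\<in>?K - ?A. ?t m)"
    using * by (auto intro!: var_power_dvd_sum_single)
  moreover have "C = (\<Sum>m\<in>?A. ?t m) + (\<Sum>m\<in>?K - ?A. ?t m)"
    using sum.subset_diff[of ?A ?K ?t] by (simp add: poly_mapping_eq_sum_single add.commute)
  ultimately show thesis using that by (elim dvdE) simp
qed

text \<open>In degree \<open>e\<close> the term \<open>l ^ (e + 1) * C'\<close> does not contribute.\<close>

lemma graded_nakayama:
  assumes l: "homogeneous 1 l"
    and zero: "0 \<in> I" and add: "\<And>g h. g \<in> I \<Longrightarrow> h \<in> I \<Longrightarrow> g + h \<in> I"
    and mult: "\<And>g h. h \<in> I \<Longrightarrow> g * h \<in> I" and hom_part: "\<And>k g. g \<in> I \<Longrightarrow> hom_part k g \<in> I"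
    and step: "\<And>C. C \<in> Q \<Longrightarrow> \<exists>C'\<in>Q. C - l * C' \<in> I"
    and C: "C \<in> Q"
  shows "C \<in> I"
proof -
  have iter: "\<exists>C'\<in>Q. C - l ^ n * C' \<in> I" for n
  proof (induction n)
    case 0 show ?case using C zero by (intro bexI[of _ C]) auto
  next
    case (Suc n)
    then obtain C1 where C1: "C1 \<in> Q" "C - l ^ n * C1 \<in> I" by blast
    obtain C2 where C2: "C2 \<in> Q" "C1 - l * C2 \<in> I" using step[OF C1(1)] by blast
    have "(C - l ^ n * C1) + l ^ n * (C1 - l * C2) \<in> I" by (intro add mult C1 C2)
    then show ?case using C2(1) by (auto simp: algebra_simps)
  qed
  have part_in: "hom_part e C \<in> I" for e
  proof -
    obtain C' where "C - l ^ Suc e * C' \<in> I" using iter by blast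
    then have "hom_part e (C - l ^ Suc e * C') \<in> I" by (rule hom_part)
    moreover have "hom_part e (l ^ Suc e * C') = 0"
      using homogeneous_power[OF l, of "Suc e"] by (subst hom_part_mult_homogeneous) auto
    ultimately show ?thesis by (simp add: hom_part_diff)
  qed
  obtain D where "C = (\<Sum>k\<le>D. hom_part k C)" using sum_hom_part by blast
  moreover have "(\<Sum>k\<in>A. hom_part k C) \<in> I" if "finite A" for A
    using that by (induction A) (auto intro: zero add part_in)
  ultimately show ?thesis by (metis finite_atMost)
qed

text \<open>\<open>\<sigma>\<close> is the restriction to the hyperplane \<open>l = 0\<close>, realised as an idempotent endomorphism of \<open>S\<close>.\<close>

locale hyperplane =
  fixes l :: S and \<sigma> :: "S \<Rightarrow> S"
  assumes l: "homogeneous 1 l" "l \<noteq> 0"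
    and \<sigma>: "ring_map \<sigma>" "\<And>g. \<sigma> (\<sigma> g) = \<sigma> g" "\<And>g. \<sigma> g = 0 \<longleftrightarrow> l dvd g"
begin

lemma \<sigma>_l: "\<sigma> l = 0"
  by (simp add: \<sigma>(3))

text \<open>Regularity on the hyperplane writes \<open>C\<close> as a multiple of \<open>X\<close>
  plus \<open>l * C'\<close>. Since \<open>\<sigma> X\<close> is nonzero, \<open>l\<close> can be
  cancelled from the relation for \<open>l * C'\<close>, so \<open>C'\<close> satisfies the same
  hypothesis as \<open>C\<close> and the graded Nakayama argument applies.\<close>

lemma regular2_lift:
  assumes X: "homogeneous N X"
    and X0: "\<sigma> X \<noteq> 0"
    and reg: "\<And>B. \<sigma> X dvd \<sigma> Y * B \<Longrightarrow> \<sigma> X dvd B"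
    and dvd: "X dvd Y * B"
  shows "X dvd B"
proof -
  have part_in: "X dvd hom_part k g" if "X dvd g" for k g
    using that by (elim dvdE) (simp add: hom_part_mult_homogeneous[OF X])
  have "B \<in> {B. X dvd B}"
  proof (rule graded_nakayama[OF l(1), where Q = "{B. X dvd Y * B}"])
    fix C assume "C \<in> {B. X dvd Y * B}"
    then obtain A where A: "Y * C = X * A" by (elim CollectE dvdE)
    have "\<sigma> Y * \<sigma> C = \<sigma> X * \<sigma> A"
      using arg_cong[OF A, of \<sigma>] by (simp add: ring_mapD[OF \<sigma>(1)])
    then have "\<sigma> X dvd \<sigma> C" using reg by simp
    then obtain \<alpha> where \<alpha>: "\<sigma> C = \<sigma> X * \<alpha>" by (rule dvdE)
    \<comment> \<open>Applying the idempotent \<open>\<sigma>\<close> to the equation for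
      \<open>\<sigma> C\<close> replaces \<alpha> by \<open>\<sigma> \<alpha>\<close>.\<close>
    have "\<sigma> (C - X * \<alpha>) = 0"
      using \<sigma>(2)[of C] \<sigma>(2)[of X] arg_cong[OF \<alpha>, of \<sigma>]
      by (simp add: ring_mapD[OF \<sigma>(1)])
    then obtain C' where C': "C - X * \<alpha> = l * C'" by (metis \<sigma>(3) dvd_def)
    have e: "l * (Y * C') = X * (A - Y * \<alpha>)"
    proof -
      have "l * (Y * C') = Y * (C - X * \<alpha>)" using C' by (simp add: algebra_simps)
      then show ?thesis using A by (simp add: algebra_simps)
    qed
    have "\<sigma> X * \<sigma> (A - Y * \<alpha>) = 0"
      using arg_cong[OF e, of \<sigma>] by (simp only: ring_mapD[OF \<sigma>(1)] \<sigma>_l mult_zero_left)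
    then have "\<sigma> (A - Y * \<alpha>) = 0" using X0 by simp
    then obtain A' where "A - Y * \<alpha> = l * A'" by (metis \<sigma>(3) dvd_def)
    then have "Y * C' = X * A'" using e l(2) by (simp add: mult.left_commute)
    moreover have "C - l * C' = X * \<alpha>" using C' by (simp add: algebra_simps)
    ultimately show "\<exists>C'\<in>{B. X dvd Y * B}. C - l * C' \<in> {B. X dvd B}"
      by (intro bexI[of _ C']) auto
  qed (simp_all add: dvd part_in)
  then show ?thesis by simp
qed

text \<open>The same argument modulo the ideal of \<open>X\<close> and \<open>Y\<close>. Cancelling
  \<open>l\<close> is now harder: the coefficients \<open>A'\<close> and \<open>B'\<close> are
  divisible by \<open>l\<close> only after a multiple of the trivial relation between
  \<open>X\<close> and \<open>Y\<close> has been removed.\<close>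

lemma regular3_lift:
  assumes X: "homogeneous N X" and Y: "homogeneous M Y"
    and reg2: "\<And>B. \<sigma> X dvd \<sigma> Y * B \<Longrightarrow> \<sigma> X dvd B"
    and X0: "\<sigma> X \<noteq> 0"
    and reg3: "\<And>a b C. \<sigma> Z * C = \<sigma> X * a + \<sigma> Y * b \<Longrightarrow> \<exists>\<alpha> \<beta>. C = \<sigma> X * \<alpha> + \<sigma> Y * \<beta>"
    and eq: "Z * C = X * a + Y * b"
  obtains \<alpha> \<beta> where "C = X * \<alpha> + Y * \<beta>"
proof -
  let ?I = "{g. \<exists>\<alpha> \<beta>. g = X * \<alpha> + Y * \<beta>}"
  have "C \<in> ?I"
  proof (rule graded_nakayama[OF l(1), where Q = "{C. Z * C \<in> ?I}"])
    show "0 \<in> ?I" by (auto intro!: exI[of _ 0])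
    show "g + h \<in> ?I" if "g \<in> ?I" "h \<in> ?I" for g h
    proof -
      obtain a b a' b' where "g = X * a + Y * b" "h = X * a' + Y * b'" using \<open>g \<in> ?I\<close> \<open>h \<in> ?I\<close> by auto
      then have "g + h = X * (a + a') + Y * (b + b')" by (simp add: algebra_simps)
      then show ?thesis by (intro CollectI exI)
    qed
    show "g * h \<in> ?I" if "h \<in> ?I" for g h
    proof -
      obtain a b where "h = X * a + Y * b" using \<open>h \<in> ?I\<close> by auto
      then have "g * h = X * (g * a) + Y * (g * b)" by (simp add: algebra_simps)
      then show ?thesis by (intro CollectI exI)
    qed
    show "hom_part k g \<in> ?I" if "g \<in> ?I" for k g
    proof -
      obtain a b where "g = X * a + Y * b" using \<open>g \<in> ?I\<close> by auto
      then have "hom_part k g = X * (if N \<le> k then hom_part (k - N) a else 0) + Y * (if M \<le> k then hom_part (k - M) b else 0)"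
        by (simp add: hom_part_add hom_part_mult_homogeneous[OF X] hom_part_mult_homogeneous[OF Y])
      then show ?thesis by (intro CollectI exI)
    qed
    show "C \<in> {C. Z * C \<in> ?I}" using eq by (intro CollectI exI)
    fix C assume "C \<in> {C. Z * C \<in> ?I}"
    then obtain A B where A: "Z * C = X * A + Y * B" by auto
    have "\<sigma> Z * \<sigma> C = \<sigma> X * \<sigma> A + \<sigma> Y * \<sigma> B"
      using arg_cong[OF A, of \<sigma>] by (simp add: ring_mapD[OF \<sigma>(1)])
    then obtain \<alpha> \<beta> where \<alpha>: "\<sigma> C = \<sigma> X * \<alpha> + \<sigma> Y * \<beta>" using reg3 by blast
    have "\<sigma> (C - (X * \<alpha> + Y * \<beta>)) = 0"
      using \<sigma>(2)[of C] \<sigma>(2)[of X] \<sigma>(2)[of Y] arg_cong[OF \<alpha>, of \<sigma>]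
      by (simp add: ring_mapD[OF \<sigma>(1)])
    then obtain C' where C': "C - (X * \<alpha> + Y * \<beta>) = l * C'" by (metis \<sigma>(3) dvd_def)
    define A' where "A' = A - Z * \<alpha>"
    define B' where "B' = B - Z * \<beta>"
    have e: "l * (Z * C') = X * A' + Y * B'"
    proof -
      have "l * (Z * C') = Z * (C - (X * \<alpha> + Y * \<beta>))" using C' by (simp add: algebra_simps)
      also have "\<dots> = Z * C - Z * (X * \<alpha> + Y * \<beta>)" by (simp add: algebra_simps)
      also have "\<dots> = X * A' + Y * B'" unfolding A A'_def B'_def by (simp add: algebra_simps)
      finally show ?thesis .
    qed
    have s: "\<sigma> X * \<sigma> A' + \<sigma> Y * \<sigma> B' = 0"
      using arg_cong[OF e, of \<sigma>] by (simp add: ring_mapD[OF \<sigma>(1)] \<sigma>_l)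
    \<comment> \<open>On the hyperplane a relation between \<open>X\<close> and \<open>Y\<close> is
      a multiple of the trivial one, so modulo \<open>l\<close> the pair \<open>A'\<close>,
      \<open>B'\<close> is \<open>- Y * \<gamma>\<close>, \<open>X * \<gamma>\<close>. These two
      contributions cancel in \<open>X * A' + Y * B'\<close>.\<close>
    then have "\<sigma> Y * \<sigma> B' = \<sigma> X * (- \<sigma> A')" by (simp add: eq_neg_iff_add_eq_0 add.commute)
    then have "\<sigma> X dvd \<sigma> B'" using reg2 by simp
    then obtain \<gamma> where \<gamma>: "\<sigma> B' = \<sigma> X * \<gamma>" by (rule dvdE)
    have "\<sigma> X * (\<sigma> A' + \<sigma> Y * \<gamma>) = \<sigma> X * \<sigma> A' + \<sigma> Y * \<sigma> B'" unfolding \<gamma> by (simp add: algebra_simps)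
    then have "\<sigma> X * (\<sigma> A' + \<sigma> Y * \<gamma>) = 0" using s by simp
    then have \<gamma>': "\<sigma> A' + \<sigma> Y * \<gamma> = 0" using X0 by simp
    have "\<sigma> (B' - X * \<gamma>) = 0" and "\<sigma> (A' + Y * \<gamma>) = 0"
      using \<sigma>(2)[of B'] \<sigma>(2)[of A'] \<sigma>(2)[of X] \<sigma>(2)[of Y] arg_cong[OF \<gamma>, of \<sigma>] arg_cong[OF \<gamma>', of \<sigma>]
      by (simp_all add: ring_mapD[OF \<sigma>(1)])
    then obtain A'' B'' where "B' - X * \<gamma> = l * B''" "A' + Y * \<gamma> = l * A''" by (metis \<sigma>(3) dvd_def)
    then have eqs: "B' = l * B'' + X * \<gamma>" "A' = l * A'' - Y * \<gamma>" by (simp_all only: eq_diff_eq diff_eq_eq)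
    have "l * (Z * C') = l * (X * A'' + Y * B'')" unfolding e eqs by (simp add: algebra_simps)
    then have "Z * C' = X * A'' + Y * B''" using l(2) by simp
    moreover have "C - l * C' = X * \<alpha> + Y * \<beta>" using C' by (simp add: algebra_simps)
    ultimately show "\<exists>C'\<in>{C. Z * C \<in> ?I}. C - l * C' \<in> ?I"
      by (intro bexI[of _ C'] CollectI exI)
  qed
  then obtain \<alpha> \<beta> where "C = X * \<alpha> + Y * \<beta>" by (elim CollectE exE)
  then show thesis by (rule that)
qed

end

subsection \<open>The weak Nullstellensatz\<close>

definition is_ideal :: "S set \<Rightarrow> bool" where
  "is_ideal I \<longleftrightarrow> 0 \<in> I \<and> (\<forall>g\<in>I. \<forall>h\<in>I. g + h \<in> I) \<and> (\<forall>g. \<forall>h\<in>I. g * h \<in> I)"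

lemma is_idealD:
  assumes "is_ideal I"
  shows "0 \<in> I" "g \<in> I \<Longrightarrow> h \<in> I \<Longrightarrow> g + h \<in> I" "h \<in> I \<Longrightarrow> g * h \<in> I" "g \<in> I \<Longrightarrow> g * h \<in> I"
    "g \<in> I \<Longrightarrow> h \<in> I \<Longrightarrow> g - h \<in> I" "(\<And>i. i \<in> A \<Longrightarrow> k i \<in> I) \<Longrightarrow> sum k A \<in> I"
proof -
  show z: "0 \<in> I" and a: "\<And>g h. g \<in> I \<Longrightarrow> h \<in> I \<Longrightarrow> g + h \<in> I" and m: "\<And>g h. h \<in> I \<Longrightarrow> g * h \<in> I"
    using assms by (auto simp: is_ideal_def)
  show "g \<in> I \<Longrightarrow> g * h \<in> I" using m[of g h] by (simp add: mult.commute)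
  show "g \<in> I \<Longrightarrow> h \<in> I \<Longrightarrow> g - h \<in> I" using a[of g "- 1 * h"] m[of h "- 1"] by simp
  show "(\<And>i. i \<in> A \<Longrightarrow> k i \<in> I) \<Longrightarrow> sum k A \<in> I"
    by (induction A rule: infinite_finite_induct) (auto intro: z a)
qed

text \<open>The ideal generated by \<open>I\<close> and \<open>k\<close>. It serves both to exploit
  maximality and to dehomogenise.\<close>

lemma is_ideal_extend: "is_ideal I \<Longrightarrow> is_ideal {g + h * k | g h. g \<in> I}"
  unfolding is_ideal_def[of "{g + h * k | g h. g \<in> I}"]
proof (intro conjI ballI allI)
  assume I: "is_ideal I"
  show "0 \<in> {g + h * k | g h. g \<in> I}" using is_idealD(1)[OF I] by (intro CollectI exI[of _ 0]) simp
  fix x y assume x: "x \<in> {g + h * k | g h. g \<in> I}"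
  then obtain g h where g: "x = g + h * k" "g \<in> I" by auto
  show "a * x \<in> {g + h * k | g h. g \<in> I}" for a
    using is_idealD(3)[OF I g(2)] g(1)
    by (intro CollectI exI[of _ "a * g"] exI[of _ "a * h"]) (simp add: algebra_simps)
  assume "y \<in> {g + h * k | g h. g \<in> I}"
  then obtain g' h' where g': "y = g' + h' * k" "g' \<in> I" by auto
  show "x + y \<in> {g + h * k | g h. g \<in> I}"
    using is_idealD(2)[OF I g(2) g'(2)] g(1) g'(1)
    by (intro CollectI exI[of _ "g + g'"] exI[of _ "h + h'"]) (simp add: algebra_simps)
qed

text \<open>Zorn's lemma. Maximality is recorded as invertibility modulo \<open>M\<close>, which
  expresses that the quotient is a field without forming it.\<close>

lemma maximal_ideal_exists:
  assumes "is_ideal I" "1 \<notin> I"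
  obtains M where "is_ideal M" "1 \<notin> M" "I \<subseteq> M"
    "\<And>k. k \<notin> M \<Longrightarrow> \<exists>h. 1 - h * k \<in> M"
proof -
  let ?P = "{M. is_ideal M \<and> 1 \<notin> M \<and> I \<subseteq> M}"
  have "\<exists>M\<in>?P. \<forall>X\<in>?P. M \<subseteq> X \<longrightarrow> X = M"
  proof (rule subset_Zorn_nonempty)
    show "?P \<noteq> {}" using assms by auto
    fix C assume C: "C \<noteq> {}" "subset.chain ?P C"
    then have id: "is_ideal M" if "M \<in> C" for M using that by (auto simp: subset.chain_def)
    have "is_ideal (\<Union>C)"
      unfolding is_ideal_def
    proof (intro conjI ballI allI)
      show "0 \<in> \<Union>C" using C(1) id is_idealD(1) by blast
      show "g * h \<in> \<Union>C" if "h \<in> \<Union>C" for g h using that id is_idealD(3) by blast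
      fix g h assume "g \<in> \<Union>C" "h \<in> \<Union>C"
      then obtain A B where AB: "A \<in> C" "B \<in> C" "g \<in> A" "h \<in> B" by auto
      then have "A \<subseteq> B \<or> B \<subseteq> A" using C(2) by (auto simp: subset.chain_def subset_iff)
      then obtain D where "D \<in> C" "g \<in> D" "h \<in> D" using AB by auto
      then show "g + h \<in> \<Union>C" using id is_idealD(2) by blast
    qed
    then show "\<Union>C \<in> ?P" using C by (auto simp: subset.chain_def)
  qed
  then obtain M where M: "M \<in> ?P" and max: "\<forall>X\<in>?P. M \<subseteq> X \<longrightarrow> X = M" by (rule bexE)
  show thesis
  proof (rule that)
    show "is_ideal M" "1 \<notin> M" "I \<subseteq> M" using M by auto
    fix k assume k: "k \<notin> M"
    let ?X = "{g + h * k | g h. g \<in> M}"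
    have sub: "M \<subseteq> ?X"
    proof
      fix x assume "x \<in> M"
      then show "x \<in> ?X" by (intro CollectI exI[of _ x] exI[of _ 0]) simp
    qed
    have "k \<in> ?X" using is_idealD(1)[OF \<open>is_ideal M\<close>]
      by (intro CollectI exI[of _ 0] exI[of _ 1]) simp
    then have "?X \<noteq> M" using k by auto
    then have "?X \<notin> ?P" using max sub by (metis (no_types, lifting))
    then have "1 \<in> ?X" using is_ideal_extend[OF \<open>is_ideal M\<close>] sub \<open>I \<subseteq> M\<close> by auto
    then obtain g h where gh: "1 = g + h * k" "g \<in> M" by auto
    have "1 - h * k = g" by (subst gh(1)) simp
    then show "\<exists>h. 1 - h * k \<in> M" using gh(2) by (intro exI[of _ h]) simp
  qed
qed

interpretation SC: vector_space "\<lambda>c (g::S). Const c * g"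
  by unfold_locales (simp_all add: algebra_simps single_add mult_single)

text \<open>Maximal ideals are prime: multiply by an inverse of \<open>k\<close> modulo
  \<open>M\<close>.\<close>

lemma mult_in_maximal_ideal:
  assumes "is_ideal M" "\<And>k. k \<notin> M \<Longrightarrow> \<exists>h. 1 - h * k \<in> M" "g * k \<in> M" "k \<notin> M"
  shows "g \<in> M"
proof -
  obtain h where h: "1 - h * k \<in> M" using assms by blast
  have "g = g * (1 - h * k) + h * (g * k)" by (simp add: algebra_simps)
  then show ?thesis using is_idealD(2,3)[OF assms(1)] h assms(3) by metis
qed

text \<open>The univariate counterpart of \<open>subst\<close>: coefficients go through
  \<open>h\<close>, the variable goes to \<open>y\<close>.\<close>

lemma ring_map_poly: "ring_map h \<Longrightarrow> ring_map (\<lambda>P. poly (map_poly h P) y)"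
  unfolding ring_map_def[of "\<lambda>P. poly (map_poly h P) y"]
proof (intro conjI allI)
  assume h: "ring_map h"
  note hD = ring_mapD[OF h]
  have add: "map_poly h (P + Q) = map_poly h P + map_poly h Q" for P Q
    by (rule poly_eqI) (simp add: coeff_map_poly hD)
  have smult: "map_poly h (smult a P) = smult (h a) (map_poly h P)" for a P
    by (rule poly_eqI) (simp add: coeff_map_poly hD)
  have pc: "map_poly h (pCons a P) = pCons (h a) (map_poly h P)" for a P
    by (rule poly_eqI) (simp add: coeff_map_poly hD coeff_pCons split: nat.split)
  show "poly (map_poly h 0) y = 0" by simp
  show "poly (map_poly h 1) y = 1" by (simp add: map_poly_1' hD)
  show "poly (map_poly h (P + Q)) y = poly (map_poly h P) y + poly (map_poly h Q) y" for P Q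
    by (simp add: add)
  show "poly (map_poly h (P * Q)) y = poly (map_poly h P) y * poly (map_poly h Q) y" for P Q
    by (induction P) (simp_all add: add smult pc hD algebra_simps)
qed

text \<open>\<open>\<complex>\<close> is uncountable while \<open>S\<close> has countable dimension over \<open>\<complex>\<close>, so the inverses modulo \<open>M\<close> of the
  elements \<open>v - c\<close> cannot be linearly independent; a linear relation among them becomes, after clearing
  denominators, a univariate polynomial that vanishes at \<open>v\<close> modulo \<open>M\<close>.\<close>

lemma maximal_ideal_const:
  assumes M: "is_ideal M" "1 \<notin> M" and max: "\<And>k. k \<notin> M \<Longrightarrow> \<exists>h. 1 - h * k \<in> M"
  shows "\<exists>c. v - Const c \<in> M"
proof (rule ccontr)
  assume no: "\<not> (\<exists>c. v - Const c \<in> M)"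
  note MD = is_idealD[OF M(1)]
  have prime: "g \<in> M" if "g * k \<in> M" "k \<notin> M" for g k
    using mult_in_maximal_ideal[OF M(1) max] that by blast
  have const: "Const c \<notin> M" if "c \<noteq> 0" for c
    using MD(3)[of "Const c" "Const (inverse c)"] M(2) that by (auto simp: mult_single)
  have "\<forall>c. \<exists>h. 1 - h * (v - Const c) \<in> M" using no max by blast
  then obtain q where q: "\<And>c. 1 - q c * (v - Const c) \<in> M" by metis
  \<comment> \<open>Two equal inverses would satisfy \<open>q c * Const (c' - c) \<in> M\<close>,
    which puts \<open>q c\<close>, and then 1, into \<open>M\<close>.\<close>
  have inj: "inj q"
  proof (rule injI, rule ccontr)
    fix c c' assume eq: "q c = q c'" and ne: "c \<noteq> c'"
    have "q c * Const (c' - c) = (1 - q c' * (v - Const c')) - (1 - q c * (v - Const c))"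
      using eq by (simp add: algebra_simps single_diff)
    then have "q c * Const (c' - c) \<in> M" using MD(5)[OF q q] by metis
    then have "q c \<in> M" using prime const ne by (metis right_minus_eq)
    then have "q c * (v - Const c) \<in> M" by (rule MD(4))
    then have "(1 - q c * (v - Const c)) + q c * (v - Const c) \<in> M" using q MD(2) by blast
    then show False using M(2) by simp
  qed
  have cnt: "countable (UNIV :: (4 \<Rightarrow>\<^sub>0 nat) set)"
  proof -
    have "inj (\<lambda>m::4 \<Rightarrow>\<^sub>0 nat. (Poly_Mapping.lookup m 1, Poly_Mapping.lookup m 2, Poly_Mapping.lookup m 3, Poly_Mapping.lookup m 4))"
      by (rule injI) (simp add: poly_mapping_eq_iff fun_eq_iff forall_4)
    then show ?thesis by (rule countableI')
  qed
  \<comment> \<open>There are only countably many finite sets of monomials, so uncountably many of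
    the inverses share one support \<open>K\<close> and lie in a finite-dimensional space.\<close>
  have "countable (range (\<lambda>c. Poly_Mapping.keys (q c)))"
    by (rule countable_subset[OF _ countable_Collect_finite_subset[OF cnt]]) auto
  moreover have "uncountable (UNIV :: complex set)"
    by (rule uncountable_UNIV_complex)
  ultimately obtain K where K: "uncountable {c. Poly_Mapping.keys (q c) = K}" "K \<in> range (\<lambda>c. Poly_Mapping.keys (q c))"
  proof -
    have "UNIV = (\<Union>K\<in>range (\<lambda>c. Poly_Mapping.keys (q c)). {c. Poly_Mapping.keys (q c) = K})" by auto
    then show thesis
      using that \<open>uncountable UNIV\<close> \<open>countable (range _)\<close> countable_UN by (metis (no_types, lifting))
  qed
  define A where "A = {c. Poly_Mapping.keys (q c) = K}"
  have infA: "infinite A" using K(1) countable_finite unfolding A_def by blast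
  have finK: "finite K" using K(2) by auto
  have "q ` A \<subseteq> SC.span ((\<lambda>m. Poly_Mapping.single m 1) ` K)"
  proof
    fix g assume "g \<in> q ` A"
    then have "g = (\<Sum>m\<in>K. Const (Poly_Mapping.lookup g m) * Poly_Mapping.single m 1)"
      using poly_mapping_eq_sum_single[of g] by (auto simp: A_def mult_single)
    also have "\<dots> \<in> SC.span ((\<lambda>m. Poly_Mapping.single m 1) ` K)"
      by (intro SC.span_sum SC.span_scale SC.span_base) auto
    finally show "g \<in> SC.span ((\<lambda>m. Poly_Mapping.single m 1) ` K)" .
  qed
  then have "SC.dependent (q ` A)"
    using SC.independent_span_bound[of "(\<lambda>m. Poly_Mapping.single m 1) ` K" "q ` A"] finK infA
      finite_imageD[of q A] inj by (auto intro: inj_on_subset)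
  then obtain T u where T: "finite T" "T \<subseteq> q ` A" "(\<Sum>g\<in>T. Const (u g) * g) = 0" "\<exists>g\<in>T. u g \<noteq> 0"
    unfolding SC.dependent_explicit by blast
  obtain F where F: "finite F" "T = q ` F"
    using finite_subset_image[OF T(1,2)] by blast
  define w where "w c = u (q c)" for c
  have rel: "(\<Sum>c\<in>F. Const (w c) * q c) = 0"
    using T(3) unfolding F(2) w_def by (subst (asm) sum.reindex) (auto intro: inj_on_subset[OF inj])
  obtain c0 where c0: "c0 \<in> F" "w c0 \<noteq> 0" using T(4) F(2) w_def by auto
  define h where "h P = poly (map_poly Const P) v" for P
  have h: "ring_map h" unfolding h_def by (rule ring_map_poly[OF ring_map_Const])
  note hD = ring_mapD[OF h]
  have h_lin: "h [:- c, 1:] = v - Const c" for c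
    unfolding h_def by (simp add: map_poly_pCons single_uminus)
  have h_const: "h [:c:] = Const c" for c
    unfolding h_def by (simp add: map_poly_pCons)
  have h_prod: "h (prod f B) = (\<Prod>x\<in>B. h (f x))" for f :: "complex \<Rightarrow> complex poly" and B
    by (induction B rule: infinite_finite_induct) (auto simp: hD)
  \<comment> \<open>The numerator of the sum of the fractions \<open>w c / (x - c)\<close>. At
    \<open>c0\<close> only the summand with index \<open>c0\<close> survives, so \<open>P\<close> is
    not zero.\<close>
  define P where "P = (\<Sum>c\<in>F. [:w c:] * (\<Prod>c'\<in>F - {c}. [:- c', 1:]))"
  have "poly P c0 = (\<Sum>c\<in>F. if c = c0 then w c * (\<Prod>c'\<in>F - {c}. c0 - c') else 0)"
    unfolding P_def poly_sum
  proof (rule sum.cong[OF refl])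
    fix c assume "c \<in> F"
    show "poly ([:w c:] * (\<Prod>c'\<in>F - {c}. [:- c', 1:])) c0 = (if c = c0 then w c * (\<Prod>c'\<in>F - {c}. c0 - c') else 0)"
      using c0(1) F(1) by (auto simp: poly_prod)
  qed
  also have "\<dots> = w c0 * (\<Prod>c'\<in>F - {c0}. c0 - c')" using c0 F(1) by simp
  also have "\<dots> \<noteq> 0" using c0 F(1) by auto
  finally have P0: "P \<noteq> 0" by auto
  have hP: "h P \<in> M"
  proof -
    \<comment> \<open>Modulo \<open>M\<close> each \<open>q c\<close> inverts
      \<open>v - Const c\<close>, so \<open>h P\<close> is congruent to the product of all
      \<open>v - Const c\<close> times the left side of \<open>rel\<close>.\<close>
    have "h P - (\<Prod>c\<in>F. v - Const c) * (\<Sum>c\<in>F. Const (w c) * q c)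
      = (\<Sum>c\<in>F. Const (w c) * (\<Prod>c'\<in>F - {c}. v - Const c') * (1 - q c * (v - Const c)))"
      unfolding P_def hD(8) sum_distrib_left sum_subtractf[symmetric]
    proof (rule sum.cong[OF refl])
      fix c assume "c \<in> F"
      then have "(\<Prod>c\<in>F. v - Const c) = (v - Const c) * (\<Prod>c'\<in>F - {c}. v - Const c')"
        using F(1) by (rule prod.remove[rotated])
      moreover have "h ([:w c:] * (\<Prod>c'\<in>F - {c}. [:- c', 1:])) = Const (w c) * (\<Prod>c'\<in>F - {c}. v - Const c')"
        by (simp only: hD(4) h_prod h_lin h_const)
      moreover have "a * R - L * R * (a * k) = a * R * (1 - k * L)" for a R L k :: S
        by (simp add: algebra_simps)
      ultimately show "h ([:w c:] * (\<Prod>c'\<in>F - {c}. [:- c', 1:])) - (\<Prod>c\<in>F. v - Const c) * (Const (w c) * q c)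
        = Const (w c) * (\<Prod>c'\<in>F - {c}. v - Const c') * (1 - q c * (v - Const c))"
        by (simp only:)
    qed
    also have "\<dots> \<in> M" by (intro MD(6) MD(3) q)
    finally show ?thesis using rel by simp
  qed
  \<comment> \<open>Over the complex numbers a nonzero polynomial splits into linear factors. None
    of them takes a value in \<open>M\<close> at \<open>v\<close>, and \<open>M\<close> is
    prime.\<close>
  have "h P \<notin> M" if "P \<noteq> 0" for P
    using that
  proof (induction "degree P" arbitrary: P)
    case 0
    then obtain c where "P = [:c:]" by (metis degree_eq_zeroE)
    then show ?case using 0 const h_const by auto
  next
    case (Suc n)
    then obtain r where "poly P r = 0"
      using fundamental_theorem_of_algebra[of P] by (auto simp: constant_degree)
    then obtain Q where Q: "P = [:- r, 1:] * Q" by (metis poly_eq_0_iff_dvd dvd_def)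
    have Q0: "Q \<noteq> 0" using Suc.prems Q by auto
    then have "degree P = degree [:- r, 1:] + degree Q" unfolding Q by (intro degree_mult_eq) auto
    then have "h Q \<notin> M" using Suc Q0 by simp
    moreover have "h P = (v - Const r) * h Q" unfolding Q by (simp add: hD(4) h_lin del: mult_pCons_left)
    ultimately show ?case using prime[of "v - Const r" "h Q"] no by auto
  qed
  then show False using hP P0 by blast
qed

text \<open>The variables are congruent to constants modulo a maximal ideal \<open>M\<close>, and
  these are the coordinates of the point. Every polynomial is then congruent to its value there, so
  a nonzero value on \<open>I\<close> would put a unit into \<open>M\<close>.\<close>

lemma weak_nullstellensatz:
  assumes "is_ideal I" "1 \<notin> I"
  obtains p where "\<And>g. g \<in> I \<Longrightarrow> eval_at p g = 0"
proof -
  obtain M where M: "is_ideal M" "1 \<notin> M" "I \<subseteq> M" "\<And>k. k \<notin> M \<Longrightarrow> \<exists>h. 1 - h * k \<in> M"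
    using maximal_ideal_exists[OF assms] by blast
  note MD = is_idealD[OF M(1)]
  have "\<forall>i. \<exists>c. var i - Const c \<in> M" using maximal_ideal_const[OF M(1,2,4)] by blast
  then obtain c where c: "\<And>i. var i - Const (c i) \<in> M" by metis
  define p :: "complex ^ 4" where "p = (\<chi> i. c i)"
  note eD = ring_mapD[OF ring_map_eval_at]
  have *: "g - Const (eval_at p g) \<in> M" for g
  proof (induction g rule: S_induct)
    case (Const c) then show ?case using MD(1) by simp
  next
    case (var i) then show ?case using c by (simp add: p_def)
  next
    case (add g h)
    then show ?case using MD(2)[OF add] by (simp add: eD single_add algebra_simps)
  next
    case (mult g h)
    have "(g - Const (eval_at p g)) * h + Const (eval_at p g) * (h - Const (eval_at p h)) \<in> M"
      by (intro MD(2) MD(3) MD(4) mult)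
    then show ?case by (simp add: eD mult_single algebra_simps flip: mult_single[of 0 _ 0, simplified])
  qed
  show thesis
  proof (rule that, rule ccontr)
    fix g assume "g \<in> I" and ne: "eval_at p g \<noteq> 0"
    then have "g - (g - Const (eval_at p g)) \<in> M" using M(3) * MD(5) by blast
    then have "Const (inverse (eval_at p g)) * Const (eval_at p g) \<in> M" using MD(3) by simp
    then show False using M(2) ne by (simp add: mult_single)
  qed
qed

subsection \<open>A regular sequence in the Jacobian ideal\<close>

text \<open>A regular sequence of length three, spelt out with elements instead of quotient
  rings.\<close>

definition regular_triple :: "S \<Rightarrow> S \<Rightarrow> S \<Rightarrow> bool" where
  "regular_triple X Y Z \<longleftrightarrow> X \<noteq> 0 \<and> (\<forall>B. X dvd Y * B \<longrightarrow> X dvd B) \<and>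
     (\<forall>a b C. Z * C = X * a + Y * b \<longrightarrow> (\<exists>\<alpha> \<beta>. C = X * \<alpha> + Y * \<beta>))"

text \<open>The coefficients follow the curve \<open>(s, s ^ 2, s ^ 3)\<close>: at most three of the
  resulting planes pass through a given nonzero point.\<close>

definition cut :: "complex \<Rightarrow> S" where
  "cut s = Const s * var 1 + Const (s ^ 2) * var 2 + Const (s ^ 3) * var 3"

definition plane :: "complex \<Rightarrow> S" where
  "plane s = var 4 - cut s"

text \<open>The plane is the graph of \<open>cut s\<close>, so restricting to it eliminates
  \<open>var 4\<close> and yields polynomials in the other three variables.\<close>

definition restrict_plane :: "complex \<Rightarrow> S \<Rightarrow> S" where
  "restrict_plane s = subst Const (\<lambda>i. if i = 4 then cut s else var i)"

lemma distinct_4: "(1::4) \<noteq> 4" "(2::4) \<noteq> 4" "(3::4) \<noteq> 4" "(1::4) \<noteq> 2" "(1::4) \<noteq> 3" "(2::4) \<noteq> 3"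
  by simp_all

lemma ring_map_restrict_plane: "ring_map (restrict_plane s)"
  unfolding restrict_plane_def by (rule ring_map_subst[OF ring_map_Const])

lemma restrict_plane_Const: "restrict_plane s (Const c) = Const c"
  unfolding restrict_plane_def by (rule subst_Const[OF ring_map_Const])

lemma restrict_plane_var: "restrict_plane s (var i) = (if i = 4 then cut s else var i)"
  unfolding restrict_plane_def by (rule subst_var[OF ring_map_Const])

lemma restrict_plane_cut: "restrict_plane s (cut s) = cut s"
  unfolding cut_def
  by (simp add: ring_mapD[OF ring_map_restrict_plane] restrict_plane_Const restrict_plane_var distinct_4)

lemma eval_at_plane:
  "eval_at p (plane s) = p $ 4 - (s * p $ 1 + s ^ 2 * p $ 2 + s ^ 3 * p $ 3)"
  by (simp add: plane_def cut_def ring_mapD[OF ring_map_eval_at])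

lemma hyperplane_plane: "hyperplane (plane s) (restrict_plane s)"
proof
  have "homogeneous (0 + 1) (Const c * var i)" for c i
    by (rule homogeneous_mult) (rule homogeneous_Const homogeneous_var)+
  then show "homogeneous 1 (plane s)"
    unfolding plane_def cut_def
    by (intro homogeneous_diff homogeneous_add) (simp_all only: homogeneous_var add_0)
  have "eval_at (axis 4 1) (plane s) \<noteq> 0"
    by (simp add: eval_at_plane axis_def distinct_4)
  then show "plane s \<noteq> 0"
    by (auto simp: ring_mapD[OF ring_map_eval_at])
  show r: "ring_map (restrict_plane s)" by (rule ring_map_restrict_plane)
  note rD = ring_mapD[OF r]
  show "restrict_plane s (restrict_plane s g) = restrict_plane s g" for g
    by (rule ring_map_S_eqI[OF ring_map_comp[OF r r] r])
       (simp_all add: restrict_plane_Const restrict_plane_var restrict_plane_cut)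
  \<comment> \<open>Eliminating \<open>var 4\<close> changes nothing modulo \<open>plane s\<close>;
    hence what restricts to zero is divisible by \<open>plane s\<close>.\<close>
  have *: "plane s dvd g - restrict_plane s g" for g
  proof (induction g rule: S_induct)
    case (Const c) show ?case by (simp add: restrict_plane_Const)
  next
    case (var i) show ?case by (auto simp: restrict_plane_var plane_def)
  next
    case (add g h)
    then have "plane s dvd (g - restrict_plane s g) + (h - restrict_plane s h)" by (rule dvd_add)
    then show ?case by (simp add: rD algebra_simps)
  next
    case (mult g h)
    then have "plane s dvd (g - restrict_plane s g) * h + restrict_plane s g * (h - restrict_plane s h)"
      by simp
    then show ?case by (simp add: rD algebra_simps)
  qed
  have p0: "restrict_plane s (plane s) = 0"
    by (simp add: plane_def rD restrict_plane_var restrict_plane_cut)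
  show "restrict_plane s g = 0 \<longleftrightarrow> plane s dvd g" for g
  proof
    assume "restrict_plane s g = 0"
    then show "plane s dvd g" using *[of g] by simp
  next
    assume "plane s dvd g"
    then show "restrict_plane s g = 0" by (elim dvdE) (simp add: rD p0)
  qed
qed

lemma exists_plane_avoiding:
  assumes "finite {vec.span {p} | p. p \<noteq> 0 \<and> (\<forall>i. eval_at p (F i) = 0)}"
  obtains s where "\<And>p. p \<noteq> 0 \<Longrightarrow> (\<And>i. eval_at p (F i) = 0) \<Longrightarrow> eval_at p (plane s) \<noteq> 0"
proof -
  let ?L = "{vec.span {p} | p. p \<noteq> 0 \<and> (\<forall>i. eval_at p (F i) = 0)}"
  have "\<forall>L\<in>?L. \<exists>p. p \<noteq> 0 \<and> L = vec.span {p}" by auto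
  then obtain r where r: "\<forall>L\<in>?L. r L \<noteq> 0 \<and> L = vec.span {r L}" by (rule bchoice[THEN exE])
  \<comment> \<open>The equation of the plane at \<open>p\<close>, read as a polynomial in
    \<open>s\<close>. Up to sign its coefficients are the coordinates of \<open>p\<close>, so it is
    nonzero and has finitely many roots.\<close>
  define Q where "Q p = [:p $ 4, - p $ 1, - p $ 2, - p $ 3:]" for p :: "complex ^ 4"
  have Q: "poly (Q p) s = eval_at p (plane s)" for p s
    by (simp add: Q_def eval_at_plane algebra_simps power2_eq_square power3_eq_cube)
  have Q0: "Q p \<noteq> 0" if "p \<noteq> 0" for p
    using that by (auto simp: Q_def vec_eq_iff forall_4)
  have "finite (\<Union>L\<in>?L. {s. poly (Q (r L)) s = 0})"
    using assms r Q0 by (intro finite_UN_I poly_roots_finite) auto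
  then obtain s where s: "s \<notin> (\<Union>L\<in>?L. {s. poly (Q (r L)) s = 0})"
    using ex_new_if_finite[OF infinite_UNIV_char_0] by blast
  show thesis
  proof (rule that)
    fix p :: "complex ^ 4" assume p: "p \<noteq> 0" "\<And>i. eval_at p (F i) = 0"
    then have L: "vec.span {p} \<in> ?L" by blast
    then have "p \<in> vec.span {r (vec.span {p})}" using bspec[OF r L] vec.span_base[of p "{p}"] by simp
    then obtain k where k: "p = k *s r (vec.span {p})" by (auto simp: vec.span_singleton)
    then have "k \<noteq> 0" using p(1) by auto
    have "eval_at p (plane s) = k * eval_at (r (vec.span {p})) (plane s)"
      by (subst k, simp add: eval_at_plane algebra_simps)
    also have "\<dots> \<noteq> 0" using s L \<open>k \<noteq> 0\<close> by (auto simp: Q)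
    finally show "eval_at p (plane s) \<noteq> 0" .
  qed
qed

section \<open>The ideal generated by the forms and a plane\<close>

definition ideal_of :: "(4 \<Rightarrow> S) \<Rightarrow> S \<Rightarrow> S set" where
  "ideal_of F l = {g. \<exists>a b. g = (\<Sum>i\<in>UNIV. a i * F i) + b * l}"

lemma is_ideal_ideal_of: "is_ideal (ideal_of F l)"
  unfolding is_ideal_def ideal_of_def
proof (intro conjI ballI allI)
  show "0 \<in> {g. \<exists>a b. g = (\<Sum>i\<in>UNIV. a i * F i) + b * l}"
    by (intro CollectI exI[of _ "\<lambda>_. 0"] exI[of _ 0]) simp
  fix g h assume "h \<in> {g. \<exists>a b. g = (\<Sum>i\<in>UNIV. a i * F i) + b * l}"
  then obtain a b where ab: "h = (\<Sum>i\<in>UNIV. a i * F i) + b * l" by auto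
  then show "k * h \<in> {g. \<exists>a b. g = (\<Sum>i\<in>UNIV. a i * F i) + b * l}" for k
    by (intro CollectI exI[of _ "\<lambda>i. k * a i"] exI[of _ "k * b"])
       (simp add: sum_distrib_left algebra_simps)
  assume "g \<in> {g. \<exists>a b. g = (\<Sum>i\<in>UNIV. a i * F i) + b * l}"
  then obtain a' b' where "g = (\<Sum>i\<in>UNIV. a' i * F i) + b' * l" by auto
  then show "g + h \<in> {g. \<exists>a b. g = (\<Sum>i\<in>UNIV. a i * F i) + b * l}"
    using ab by (intro CollectI exI[of _ "\<lambda>i. a' i + a i"] exI[of _ "b' + b"])
       (simp add: sum.distrib algebra_simps)
qed

lemma hom_part_combination:
  fixes F :: "4 \<Rightarrow> S"
  assumes "\<And>i. homogeneous n (F i)"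
  shows "hom_part k (\<Sum>i\<in>UNIV. a i * F i) = (\<Sum>i\<in>UNIV. (if n \<le> k then hom_part (k - n) (a i) else 0) * F i)"
proof -
  have "hom_part k (a i * F i) = (if n \<le> k then hom_part (k - n) (a i) else 0) * F i" for i
    using hom_part_mult_homogeneous[OF assms, of k i "a i"] by (simp add: mult.commute)
  then show ?thesis by (simp add: hom_part_sum)
qed

lemma hom_part_ideal_of:
  assumes F: "\<And>i. homogeneous n (F i)" and l: "homogeneous 1 l" and g: "g \<in> ideal_of F l"
  shows "hom_part k g \<in> ideal_of F l"
proof -
  obtain a b where "g = (\<Sum>i\<in>UNIV. a i * F i) + b * l" using g by (auto simp: ideal_of_def)
  then have "hom_part k g = (\<Sum>i\<in>UNIV. (if n \<le> k then hom_part (k - n) (a i) else 0) * F i)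
      + (if 1 \<le> k then hom_part (k - 1) b else 0) * l"
    using hom_part_mult_homogeneous[OF l, of k b] hom_part_combination[where F = F, OF F, of k a]
    by (simp add: hom_part_add mult.commute[of b l] mult.commute[of _ l])
  then show ?thesis unfolding ideal_of_def by (intro CollectI exI)
qed

text \<open>The projective Nullstellensatz. Dehomogenising at \<open>var j = 1\<close> writes \<open>1 = g + h * (var j - 1)\<close> with
  \<open>g\<close> in the ideal; comparing homogeneous components, that of \<open>h\<close> in degree \<open>k\<close> is \<open>- var j ^ k\<close>
  modulo the ideal, and it vanishes for large \<open>k\<close>.\<close>

lemma var_power_in_ideal_of:
  assumes F: "\<And>i. homogeneous n (F i)" and l: "homogeneous 1 l"
    and nz: "\<And>p. p \<noteq> 0 \<Longrightarrow> (\<And>i. eval_at p (F i) = 0) \<Longrightarrow> eval_at p l \<noteq> 0"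
  obtains D where "\<And>k. k > D \<Longrightarrow> var j ^ k \<in> ideal_of F l"
proof -
  let ?J = "ideal_of F l"
  let ?I = "{g + h * (var j - 1) | g h. g \<in> ?J}"
  note J = is_ideal_ideal_of[of F l]
  note JD = is_idealD[OF J]
  \<comment> \<open>A common zero of \<open>?I\<close> would be a zero of the forms on
    \<open>l = 0\<close>, hence the origin, but \<open>var j\<close> would have the value 1
    there.\<close>
  have "1 \<in> ?I"
  proof (rule ccontr)
    assume "1 \<notin> ?I"
    then obtain p where p: "\<And>g. g \<in> ?I \<Longrightarrow> eval_at p g = 0"
      using weak_nullstellensatz[OF is_ideal_extend[OF J]] by blast
    have sub: "g \<in> ?I" if "g \<in> ?J" for g
      using that by (intro CollectI exI[of _ g] exI[of _ 0]) simp
    have "F i \<in> ?J" for i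
      unfolding ideal_of_def
      by (intro CollectI exI[of _ "\<lambda>k. if k = i then 1 else 0"] exI[of _ 0])
         (simp add: if_distrib[of "\<lambda>x. x * _"] cong: if_cong)
    then have "eval_at p (F i) = 0" for i using p sub by blast
    moreover have "l \<in> ?J"
      unfolding ideal_of_def by (intro CollectI exI[of _ "\<lambda>_. 0"] exI[of _ 1]) simp
    then have "eval_at p l = 0" using p sub by blast
    ultimately have "p = 0" using nz by blast
    have "var j - 1 \<in> ?I"
      by (intro CollectI exI[of _ 0] exI[of _ 1]) (simp add: JD(1))
    then have "eval_at p (var j - 1) = 0" by (rule p)
    then show False using \<open>p = 0\<close> by (simp add: ring_mapD[OF ring_map_eval_at])
  qed
  then obtain g h where gh: "1 = g + h * (var j - 1)" "g \<in> ?J" by auto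
  have comp: "hom_part k 1 = hom_part k g + (if 1 \<le> k then var j * hom_part (k - 1) h else 0) - hom_part k h" for k
  proof -
    have "1 = g + var j * h - h" using gh(1) by (simp add: algebra_simps)
    then have "hom_part k 1 = hom_part k (g + var j * h - h)" by simp
    also have "\<dots> = hom_part k g + hom_part k (var j * h) - hom_part k h" by (simp add: hom_part_add hom_part_diff)
    finally show ?thesis by (simp only: hom_part_mult_homogeneous[OF homogeneous_var])
  qed
  have hcJ: "hom_part k g \<in> ?J" for k by (rule hom_part_ideal_of[OF F l gh(2)])
  have main: "hom_part k h + var j ^ k \<in> ?J" for k
  proof (induction k)
    case 0
    have "hom_part 0 h + 1 = hom_part 0 g" using comp[of 0] hom_part_homogeneous[OF homogeneous_one, of 0]
      by (simp add: eq_diff_eq add.commute)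
    then show ?case using hcJ[of 0] by simp
  next
    case (Suc k)
    have "hom_part (Suc k) h = hom_part (Suc k) g + var j * hom_part k h"
      using comp[of "Suc k"] hom_part_homogeneous[OF homogeneous_one, of "Suc k"] by simp
    then have "hom_part (Suc k) h + var j ^ Suc k = hom_part (Suc k) g + var j * (hom_part k h + var j ^ k)"
      by (simp add: algebra_simps)
    also have "\<dots> \<in> ?J" by (intro JD(2) JD(3) hcJ Suc)
    finally show ?case .
  qed
  obtain D where D: "\<And>k. k > D \<Longrightarrow> hom_part k h = 0" using hom_part_eventually_zero by blast
  show thesis
  proof (rule that)
    fix k assume "k > D"
    then show "var j ^ k \<in> ?J" using main[of k] D by simp
  qed
qed

text \<open>Modulo a suitable plane the ideal of the forms contains a common power of
  \<open>var 1\<close>, \<open>var 2\<close> and \<open>var 3\<close>. Homogeneous lifts of these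
  powers stay regular by the two lifting lemmas.\<close>

lemma regular_triple_in_ideal:
  fixes F :: "4 \<Rightarrow> S"
  assumes F: "\<And>i. homogeneous n (F i)"
    and fin: "finite {vec.span {p} | p. p \<noteq> 0 \<and> (\<forall>i. eval_at p (F i) = 0)}"
  obtains a b c where "regular_triple (\<Sum>i\<in>UNIV. a i * F i) (\<Sum>i\<in>UNIV. b i * F i) (\<Sum>i\<in>UNIV. c i * F i)"
proof -
  obtain s where s: "\<And>p. p \<noteq> 0 \<Longrightarrow> (\<And>i. eval_at p (F i) = 0) \<Longrightarrow> eval_at p (plane s) \<noteq> 0"
    using exists_plane_avoiding[OF fin] by blast
  interpret hyperplane "plane s" "restrict_plane s" by (rule hyperplane_plane)
  have "\<exists>D. \<forall>k>D. var j ^ k \<in> ideal_of F (plane s)" for j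
    using var_power_in_ideal_of[where F = F and l = "plane s" and n = n, OF F l(1) s, of j] by blast
  then obtain D where D: "\<And>j k. k > D j \<Longrightarrow> var j ^ k \<in> ideal_of F (plane s)" by metis
  \<comment> \<open>One positive exponent beyond the bounds for the three variables that survive on
    the plane.\<close>
  define N where "N = Suc (D 1 + D 2 + D 3)"
  have lift: "\<exists>a. homogeneous N (\<Sum>i\<in>UNIV. a i * F i) \<and> restrict_plane s (\<Sum>i\<in>UNIV. a i * F i) = var j ^ N"
    if j: "j \<noteq> 4" "D j < N" for j
  proof -
    obtain a b where ab: "var j ^ N = (\<Sum>i\<in>UNIV. a i * F i) + b * plane s"
      using D[OF j(2)] by (auto simp: ideal_of_def)
    \<comment> \<open>The part of the coefficients that contributes in degree \<open>N\<close>, so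
      that the lift is homogeneous. It is zero when the forms have degree above
      \<open>N\<close>.\<close>
    define a' where "a' i = (if n \<le> N then hom_part (N - n) (a i) else 0)" for i
    have a': "(\<Sum>i\<in>UNIV. a' i * F i) = hom_part N (\<Sum>i\<in>UNIV. a i * F i)"
      unfolding a'_def by (simp add: hom_part_combination[OF F])
    have "var j ^ N = hom_part N (var j ^ N)"
      using hom_part_homogeneous[OF homogeneous_power[OF homogeneous_var[of j], of N], of N] by simp
    also have "\<dots> = (\<Sum>i\<in>UNIV. a' i * F i) + hom_part N (plane s * b)"
      by (subst ab) (simp only: hom_part_add a' mult.commute[of b "plane s"])
    also have "\<dots> = (\<Sum>i\<in>UNIV. a' i * F i) + plane s * hom_part (N - 1) b"
      using hom_part_mult_homogeneous[OF l(1), of N b] by (simp add: N_def)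
    finally have "restrict_plane s (var j ^ N) = restrict_plane s (\<Sum>i\<in>UNIV. a' i * F i)"
      by (simp add: ring_mapD(3,4)[OF \<sigma>(1)] \<sigma>_l)
    moreover have "restrict_plane s (var j ^ N) = var j ^ N"
      using j(1) by (simp add: ring_mapD(7)[OF \<sigma>(1)] restrict_plane_var)
    ultimately show ?thesis
      by (intro exI[of _ a'] conjI) (simp_all only: a' homogeneous_hom_part)
  qed
  have "D 1 < N" "D 2 < N" "D 3 < N" by (simp_all add: N_def)
  then obtain a b c where
      a: "homogeneous N (\<Sum>i\<in>UNIV. a i * F i)" "restrict_plane s (\<Sum>i\<in>UNIV. a i * F i) = var 1 ^ N"
    and b: "homogeneous N (\<Sum>i\<in>UNIV. b i * F i)" "restrict_plane s (\<Sum>i\<in>UNIV. b i * F i) = var 2 ^ N"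
    and c: "homogeneous N (\<Sum>i\<in>UNIV. c i * F i)" "restrict_plane s (\<Sum>i\<in>UNIV. c i * F i) = var 3 ^ N"
    using lift[OF distinct_4(1)] lift[OF distinct_4(2)] lift[OF distinct_4(3)] \<open>D 1 < N\<close> \<open>D 2 < N\<close> \<open>D 3 < N\<close>
    by blast
  let ?X = "\<Sum>i\<in>UNIV. a i * F i" and ?Y = "\<Sum>i\<in>UNIV. b i * F i" and ?Z = "\<Sum>i\<in>UNIV. c i * F i"
  have X0: "restrict_plane s ?X \<noteq> 0" 
  proof -
    have "Poly_Mapping.keys (var 1 ^ N) \<noteq> {}" by (simp add: var_power)
    then show ?thesis unfolding a(2) by auto
  qed
  have reg2: "restrict_plane s ?X dvd B" if "restrict_plane s ?X dvd restrict_plane s ?Y * B" for B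
    using that unfolding a(2) b(2) by (rule var_power_dvd_cancel[rotated]) (rule distinct_4)
  have reg3: "\<exists>\<alpha> \<beta>. C = restrict_plane s ?X * \<alpha> + restrict_plane s ?Y * \<beta>"
    if "restrict_plane s ?Z * C = restrict_plane s ?X * u + restrict_plane s ?Y * v" for C u v
    using var_power_regular[of 1 3 2 N C u v] distinct_4 that unfolding a(2) b(2) c(2) by metis
  have "regular_triple ?X ?Y ?Z"
    unfolding regular_triple_def
  proof (intro conjI allI impI)
    show "?X \<noteq> 0" using X0 by (metis \<sigma>(1) ring_mapD(1))
    show "?X dvd B" if "?X dvd ?Y * B" for B
      by (rule regular2_lift[OF a(1) X0 reg2 that])
    fix u v C assume eq: "?Z * C = ?X * u + ?Y * v"
    obtain \<alpha> \<beta> where "C = ?X * \<alpha> + ?Y * \<beta>"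
      by (rule regular3_lift[OF a(1) b(1) reg2 X0 reg3 eq])
    then show "\<exists>\<alpha> \<beta>. C = ?X * \<alpha> + ?Y * \<beta>" by (intro exI)
  qed
  then show thesis by (rule that)
qed

subsection \<open>Exactness of the Koszul complex\<close>

context
  fixes F a b c :: "4 \<Rightarrow> S" and X Y Z :: S
  assumes reg: "regular_triple X Y Z"
    and X: "X = (\<Sum>i\<in>UNIV. a i * F i)" and Y: "Y = (\<Sum>i\<in>UNIV. b i * F i)" and Z: "Z = (\<Sum>i\<in>UNIV. c i * F i)"
begin

lemma X_nonzero: "X \<noteq> 0"
  using reg unfolding regular_triple_def by blast

lemma X_dvd: "X dvd Y * B \<Longrightarrow> X dvd B"
  using reg unfolding regular_triple_def by blast

lemma F_nonzero: obtains j where "F j \<noteq> 0"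
proof -
  have "\<exists>j. F j \<noteq> 0"
  proof (rule ccontr)
    assume "\<not> (\<exists>j. F j \<noteq> 0)"
    then show False using X_nonzero by (simp add: X)
  qed
  then show thesis using that by blast
qed

text \<open>Exactness at 1-forms: the hypothesis says that \<open>v\<close> wedged with
  \<open>F\<close> vanishes. Contracting with \<open>a\<close> and \<open>b\<close> gives
  \<open>X * v j = F j * u\<close> and \<open>Y * v j = F j * w\<close>, hence
  \<open>Y * u = X * w\<close>, so \<open>X\<close> divides \<open>u\<close> and can be
  cancelled.\<close>

lemma koszul_exact1:
  assumes v: "\<And>i j. F i * v j = F j * v i"
  obtains e where "\<And>j. v j = F j * e"
proof -
  have contract: "(\<Sum>i\<in>UNIV. h i * F i) * v j = F j * (\<Sum>i\<in>UNIV. h i * v i)" for h j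
    unfolding sum_distrib_right sum_distrib_left
  proof (rule sum.cong[OF refl])
    fix i
    show "h i * F i * v j = F j * (h i * v i)"
      using arg_cong[OF v[of i j], of "(*) (h i)"] by (simp add: mult.assoc mult.left_commute)
  qed
  define u where "u = (\<Sum>i\<in>UNIV. a i * v i)"
  define w where "w = (\<Sum>i\<in>UNIV. b i * v i)"
  have Xv: "X * v j = F j * u" and Yv: "Y * v j = F j * w" for j
    unfolding X Y u_def w_def by (rule contract)+
  obtain j where j: "F j \<noteq> 0" by (rule F_nonzero)
  have "F j * (Y * u) = F j * (X * w)" using Xv[of j] Yv[of j] by (metis mult.left_commute)
  then have "Y * u = X * w" using j by simp
  then have "X dvd u" using X_dvd by simp
  then obtain e where e: "u = X * e" by (rule dvdE)
  show thesis
  proof (rule that)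
    fix j
    have "X * v j = X * (F j * e)" using Xv[of j] e by (simp add: mult.left_commute)
    then show "v j = F j * e" using X_nonzero by simp
  qed
qed

text \<open>Exactness at 2-forms. Contracting with \<open>a\<close>, \<open>b\<close>,
  \<open>c\<close> makes \<open>X W\<close>, \<open>Y W\<close>, \<open>Z W\<close> the wedges of
  \<open>F\<close> with \<open>u\<close>, \<open>v\<close>, \<open>s\<close>. By exactness at
  1-forms, \<open>Y u - X v\<close> and its two cyclic companions are multiples \<open>p\<close>,
  \<open>q\<close>, \<open>r\<close> of \<open>F\<close>, with
  \<open>Z * p + X * q + Y * r = 0\<close>. So \<open>p = X * \<alpha> + Y * \<beta>\<close>, and
  subtracting \<open>\<beta> F\<close> from \<open>u\<close> makes it divisible by
  \<open>X\<close>.\<close>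

lemma koszul_exact2:
  assumes anti: "\<And>i j. W j i = - W i j"
    and W: "\<And>i j k. F i * W j k + F j * W k i + F k * W i j = 0"
  obtains \<omega> where "\<And>j k. W j k = F j * \<omega> k - F k * \<omega> j"
proof -
  have contract: "(\<Sum>i\<in>UNIV. h i * F i) * W j k = F j * (\<Sum>i\<in>UNIV. h i * W i k) - F k * (\<Sum>i\<in>UNIV. h i * W i j)"
    for h j k
    unfolding sum_distrib_right sum_distrib_left sum_subtractf[symmetric]
  proof (rule sum.cong[OF refl])
    fix i
    have "F i * W j k - F j * W i k + F k * W i j = 0"
      using W[of i j k] anti[of k i] by simp
    then have "h i * (F i * W j k - F j * W i k + F k * W i j) = 0" by simp
    then show "h i * F i * W j k = F j * (h i * W i k) - F k * (h i * W i j)"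
      by (simp add: algebra_simps)
  qed
  define u where "u k = (\<Sum>i\<in>UNIV. a i * W i k)" for k
  define v where "v k = (\<Sum>i\<in>UNIV. b i * W i k)" for k
  define s where "s k = (\<Sum>i\<in>UNIV. c i * W i k)" for k
  have XW: "X * W j k = F j * u k - F k * u j" and YW: "Y * W j k = F j * v k - F k * v j"
    and ZW: "Z * W j k = F j * s k - F k * s j" for j k
    unfolding X Y Z u_def v_def s_def by (rule contract)+
  have *: "\<exists>e. \<forall>j. B * x j - A * y j = F j * e"
    if xy: "\<And>i j. A * W i j = F i * x j - F j * x i" "\<And>i j. B * W i j = F i * y j - F j * y i" for A B x y
  proof -
    have "F i * (B * x j - A * y j) = F j * (B * x i - A * y i)" for i j
    proof -
      have "F i * (B * x j - A * y j) - F j * (B * x i - A * y i)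
          = B * (F i * x j - F j * x i) - A * (F i * y j - F j * y i)"
        by (simp add: algebra_simps)
      also have "\<dots> = 0" unfolding xy[symmetric] by simp
      finally show ?thesis by simp
    qed
    then obtain e where "\<And>j. B * x j - A * y j = F j * e"
      using koszul_exact1[of "\<lambda>j. B * x j - A * y j"] by blast
    then show ?thesis by (intro exI[of _ e]) simp
  qed
  obtain p where p: "\<forall>j. Y * u j - X * v j = F j * p" using *[OF XW YW] by (rule exE)
  obtain q where q: "\<forall>j. Z * v j - Y * s j = F j * q" using *[OF YW ZW] by (rule exE)
  obtain r where r: "\<forall>j. X * s j - Z * u j = F j * r" using *[OF ZW XW] by (rule exE)
  obtain j where j: "F j \<noteq> 0" by (rule F_nonzero)
  have "F j * (Z * p + X * q + Y * r) = Z * (F j * p) + X * (F j * q) + Y * (F j * r)"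
    by (simp add: algebra_simps)
  also have "\<dots> = 0" unfolding p[rule_format, symmetric] q[rule_format, symmetric] r[rule_format, symmetric] by (simp add: algebra_simps)
  finally have "Z * p + X * q + Y * r = 0" using j by simp
  then have "Z * p = X * (- q) + Y * (- r)" by (simp add: add_eq_0_iff algebra_simps)
  then obtain \<alpha> \<beta> where ab: "p = X * \<alpha> + Y * \<beta>"
    using reg unfolding regular_triple_def by blast
  have "X dvd u k - F k * \<beta>" for k
  proof (rule X_dvd)
    have "Y * (u k - F k * \<beta>) = X * (v k + F k * \<alpha>)"
      using spec[OF p, of k] unfolding ab by (simp add: algebra_simps)
    then show "X dvd Y * (u k - F k * \<beta>)" by simp
  qed
  then obtain \<omega> where \<omega>: "\<And>k. u k - F k * \<beta> = X * \<omega> k" unfolding dvd_def by metis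
  show thesis
  proof (rule that)
    fix j k
    have "X * W j k = F j * (u k - F k * \<beta>) - F k * (u j - F j * \<beta>)"
      unfolding XW by (simp add: algebra_simps)
    also have "\<dots> = X * (F j * \<omega> k - F k * \<omega> j)" unfolding \<omega> by (simp add: algebra_simps)
    finally show "W j k = F j * \<omega> k - F k * \<omega> j" using X_nonzero by simp
  qed
qed

text \<open>\<open>W\<close> is the Hodge dual of \<open>x \<and> y\<close>.\<close>

lemma syzygies_proportional:
  assumes F: "\<And>i. homogeneous n (F i)"
    and x: "(\<Sum>i\<in>UNIV. x i * F i) = 0" "\<And>i. homogeneous k (x i)"
    and y: "(\<Sum>i\<in>UNIV. y i * F i) = 0" "\<And>i. homogeneous m (y i)"
    and less: "k + m < n"
  shows "x i * y j = x j * y i"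
proof -
  define M where "M i j = x i * y j - x j * y i" for i j
  define W :: "4 \<Rightarrow> 4 \<Rightarrow> S" where "W i j =
     (if i = 1 \<and> j = 2 then M 3 4 else if i = 2 \<and> j = 1 then M 4 3 else
      if i = 1 \<and> j = 3 then M 4 2 else if i = 3 \<and> j = 1 then M 2 4 else
      if i = 1 \<and> j = 4 then M 2 3 else if i = 4 \<and> j = 1 then M 3 2 else
      if i = 2 \<and> j = 3 then M 1 4 else if i = 3 \<and> j = 2 then M 4 1 else
      if i = 2 \<and> j = 4 then M 3 1 else if i = 4 \<and> j = 2 then M 1 3 else
      if i = 3 \<and> j = 4 then M 1 2 else if i = 4 \<and> j = 3 then M 2 1 else 0)" for i j
  note ne = distinct_4 distinct_4[symmetric]
  have M_anti: "M j i = - M i j" for i j by (simp add: M_def)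
  have anti: "\<forall>i j. W j i = - W i j"
    unfolding forall_4 by (simp add: W_def ne M_anti[of 3 4] M_anti[of 4 2] M_anti[of 2 3] M_anti[of 1 4] M_anti[of 3 1] M_anti[of 1 2])
  have R: "F 1 * M 1 j + F 2 * M 2 j + F 3 * M 3 j + F 4 * M 4 j = 0" for j
  proof -
    have "F 1 * M 1 j + F 2 * M 2 j + F 3 * M 3 j + F 4 * M 4 j
      = (\<Sum>i\<in>UNIV. x i * F i) * y j - x j * (\<Sum>i\<in>UNIV. y i * F i)"
      unfolding sum_4 M_def by (simp add: algebra_simps)
    then show ?thesis using x(1) y(1) by simp
  qed
  have M0: "M i i = 0" for i by (simp add: M_def)
  have R': "F 1 * M 1 4 + F 2 * M 2 4 + F 3 * M 3 4 = 0" "F 1 * M 1 3 + F 2 * M 2 3 - F 4 * M 3 4 = 0"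
    "F 1 * M 1 2 - F 3 * M 2 3 + F 4 * M 4 2 = 0" "- F 2 * M 1 2 + F 3 * M 3 1 - F 4 * M 1 4 = 0"
    using R[of 4] R[of 3] R[of 2] R[of 1] M_anti[of 3 4] M_anti[of 2 3] M_anti[of 1 2] M_anti[of 1 4]
    by (simp_all add: M0)
  \<comment> \<open>Wedging the Hodge dual of a 2-form with \<open>F\<close> amounts to contracting
    the 2-form with \<open>F\<close>, so this is \<open>R\<close> again.\<close>
  have "\<forall>i j k. F i * W j k + F j * W k i + F k * W i j = 0"
    unfolding forall_4 using R'
    by (simp add: W_def ne M_anti[of 3 4] M_anti[of 4 2] M_anti[of 2 3] M_anti[of 1 4] M_anti[of 3 1] M_anti[of 1 2] algebra_simps)
  then obtain \<omega> where \<omega>: "\<And>j k. W j k = F j * \<omega> k - F k * \<omega> j"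
    using koszul_exact2[of W] anti by blast
  have hM: "homogeneous (k + m) (M i j)" for i j
    unfolding M_def by (intro homogeneous_diff homogeneous_mult x y)
  have "homogeneous (k + m) (W i j)" for i j
    by (simp add: W_def hM)
  then have "W i j = hom_part (k + m) (W i j)" for i j by (subst hom_part_homogeneous) auto
  \<comment> \<open>The entries of \<open>W\<close> have degree \<open>k + m < n\<close>, but
    multiples of \<open>F\<close> have no components below degree \<open>n\<close>.\<close>
  then have W0: "W i j = 0" for i j
    using less by (simp add: \<omega> hom_part_diff hom_part_mult_homogeneous[OF F])
  have "\<forall>i j. M i j = 0"
    unfolding forall_4 
    using W0[of 1 2] W0[of 2 1] W0[of 1 3] W0[of 3 1] W0[of 1 4] W0[of 4 1]
      W0[of 2 3] W0[of 3 2] W0[of 2 4] W0[of 4 2] W0[of 3 4] W0[of 4 3]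
    by (simp add: W_def ne M0)
  then show ?thesis by (simp add: M_def)
qed

text \<open>In coordinates with respect to the basis, \<open>Z p + X q + Y r = 0\<close> and
  regularity give \<open>p = X \<alpha>' + Y \<beta>'\<close> with syzygies
  \<open>\<alpha>'\<close>, \<open>\<beta>'\<close>. Comparing with \<open>p = X b - Y a\<close>,
  the vector \<open>a + \<beta>'\<close> is divisible by \<open>X\<close>; its pairing with
  \<open>F\<close> is still \<open>X\<close>, so the quotient pairs to 1.\<close>

lemma free_syzygies_imp_unit:
  assumes B: "S4.independent B" "S4.span B = {v. (\<Sum>i\<in>UNIV. v $ i * F i) = 0}"
  obtains e where "(\<Sum>i\<in>UNIV. e i * F i) = 1"
proof -
  let ?AR = "{v. (\<Sum>i\<in>UNIV. v $ i * F i) = 0}"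
  define p :: "S ^ 4" where "p = (\<chi> i. X * b i - Y * a i)"
  define q :: "S ^ 4" where "q = (\<chi> i. Y * c i - Z * b i)"
  define r :: "S ^ 4" where "r = (\<chi> i. Z * a i - X * c i)"
  have lin: "(\<Sum>i\<in>UNIV. (A * g i - A' * g' i) * F i) = A * (\<Sum>i\<in>UNIV. g i * F i) - A' * (\<Sum>i\<in>UNIV. g' i * F i)"
    for A A' g g' by (simp add: sum_distrib_left sum_subtractf algebra_simps)
  have "p \<in> ?AR" "q \<in> ?AR" "r \<in> ?AR"
    by (simp_all add: p_def q_def r_def lin flip: X Y Z)
  then have pB: "p \<in> S4.span B" "q \<in> S4.span B" "r \<in> S4.span B" using B(2) by simp_all
  have rel: "Z *s p + X *s q + Y *s r = 0"
    by (simp add: vec_eq_iff p_def q_def r_def algebra_simps)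
  have ex: "\<exists>T. finite T \<and> T \<subseteq> B \<and> v \<in> S4.span T" if v: "v \<in> S4.span B" for v
  proof -
    obtain T g where "finite T" "T \<subseteq> B" "v = (\<Sum>w\<in>T. g w *s w)"
      using v unfolding S4.span_explicit by blast
    then show ?thesis by (intro exI[of _ T]) (auto intro: S4.span_sum S4.span_scale S4.span_base)
  qed
  obtain T1 T2 T3 where T': "finite T1" "T1 \<subseteq> B" "p \<in> S4.span T1" "finite T2" "T2 \<subseteq> B" "q \<in> S4.span T2"
    "finite T3" "T3 \<subseteq> B" "r \<in> S4.span T3"
    using ex[OF pB(1)] ex[OF pB(2)] ex[OF pB(3)] by blast
  \<comment> \<open>A finite part of the basis that carries all three syzygies, so that their
    coordinates share an index set.\<close>
  define T where "T = T1 \<union> T2 \<union> T3"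
  have T: "finite T" "T \<subseteq> B" using T' by (auto simp: T_def)
  have "p \<in> S4.span T" "q \<in> S4.span T" "r \<in> S4.span T"
    using T'(3,6,9) S4.span_mono[of T1 T] S4.span_mono[of T2 T] S4.span_mono[of T3 T]
    by (auto simp: T_def)
  then obtain P Q R where P: "p = (\<Sum>w\<in>T. P w *s w)" and Q: "q = (\<Sum>w\<in>T. Q w *s w)"
      and R: "r = (\<Sum>w\<in>T. R w *s w)"
    unfolding S4.span_finite[OF T(1)] by blast
  have "(\<Sum>w\<in>T. (Z * P w + X * Q w + Y * R w) *s w) = 0"
    using rel unfolding P Q R
    by (simp add: S4.scale_sum_right sum.distrib S4.scale_left_distrib)
  then have "Z * P w + X * Q w + Y * R w = 0" if "w \<in> T" for w
    using S4.independentD[OF B(1) T _ that, of "\<lambda>w. Z * P w + X * Q w + Y * R w"] by simp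
  then have "Z * P w = X * (- Q w) + Y * (- R w)" if "w \<in> T" for w
    using that by (simp add: add_eq_0_iff algebra_simps)
  then have "\<forall>w\<in>T. \<exists>\<alpha> \<beta>. P w = X * \<alpha> + Y * \<beta>"
    using reg unfolding regular_triple_def by blast
  then obtain \<alpha> \<beta> where ab: "\<And>w. w \<in> T \<Longrightarrow> P w = X * \<alpha> w + Y * \<beta> w" by metis
  define \<alpha>' \<beta>' where "\<alpha>' = (\<Sum>w\<in>T. \<alpha> w *s w)" and "\<beta>' = (\<Sum>w\<in>T. \<beta> w *s w)"
  have "\<beta>' \<in> S4.span B"
    unfolding \<beta>'_def using T(2) by (intro S4.span_sum S4.span_scale S4.span_base) auto
  then have \<beta>0: "(\<Sum>i\<in>UNIV. \<beta>' $ i * F i) = 0" using B(2) by simp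
  have "p = X *s \<alpha>' + Y *s \<beta>'"
    unfolding P \<alpha>'_def \<beta>'_def S4.scale_sum_right sum.distrib[symmetric]
    by (rule sum.cong[OF refl]) (simp add: ab S4.scale_left_distrib)
  then have pi: "X * b i - Y * a i = X * \<alpha>' $ i + Y * \<beta>' $ i" for i
    by (simp add: p_def vec_eq_iff)
  have "X dvd a i + \<beta>' $ i" for i
  proof (rule X_dvd)
    have "Y * (a i + \<beta>' $ i) = X * (b i - \<alpha>' $ i)" using pi[of i] by (simp add: algebra_simps)
    then show "X dvd Y * (a i + \<beta>' $ i)" by simp
  qed
  then obtain e where e: "\<And>i. a i + \<beta>' $ i = X * e i" unfolding dvd_def by metis
  have "X * (\<Sum>i\<in>UNIV. e i * F i) = (\<Sum>i\<in>UNIV. (a i + \<beta>' $ i) * F i)"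
    by (simp add: e sum_distrib_left mult.assoc)
  also have "\<dots> = X * 1" using \<beta>0 by (simp add: distrib_right sum.distrib X)
  finally show thesis using that X_nonzero by (simp only: mult_cancel_left) blast
qed

end

subsection \<open>Unique factorisation\<close>

lemma ring_map_poly_Const:
  assumes "ring_map h" shows "poly (map_poly h [:a:]) y = h a"
  using ring_mapD(1)[OF assms] by (simp add: map_poly_pCons)

lemma ring_map_poly_X:
  assumes "ring_map h" shows "poly (map_poly h [:0, 1:]) y = y"
  using ring_mapD(1,2)[OF assms] by (simp add: map_poly_pCons)

lemma ring_map_poly_eqI:
  fixes h k :: "'a::comm_ring_1 poly \<Rightarrow> 'b::comm_ring_1"
  assumes "ring_map h" "ring_map k" "\<And>a. h [:a:] = k [:a:]" "h [:0, 1:] = k [:0, 1:]"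
  shows "h P = k P"
proof (induction P)
  case 0 show ?case by (simp add: ring_mapD(1)[OF assms(1)] ring_mapD(1)[OF assms(2)])
next
  case (pCons a P)
  have "pCons a P = [:a:] + [:0, 1:] * P" by simp
  then show ?case using pCons(2) assms(3,4)
    by (simp only: ring_mapD(3,4)[OF assms(1)] ring_mapD(3,4)[OF assms(2)])
qed

lemma ring_map_poly_const_hom: "ring_map h \<Longrightarrow> ring_map (\<lambda>x. [:h x:])"
  by (simp add: ring_map_def)

text \<open>The library knows gcds in iterated univariate polynomial rings only, so they are transported along
  an isomorphism of \<open>S\<close> with such a ring.\<close>

definition to_iter :: "S \<Rightarrow> complex poly poly poly poly" where
  "to_iter = subst (\<lambda>c. [:[:[:[:c:]:]:]:])
     (\<lambda>i. if i = 1 then [:[:[:[:0, 1:]:]:]:] else if i = 2 then [:[:[:0, 1:]:]:] else if i = 3 then [:[:0, 1:]:] else [:0, 1:])"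

text \<open>The inverse of \<open>to_iter\<close> is built one layer at a time, from the innermost
  variable \<open>var 1\<close> to the outermost \<open>var 4\<close>.\<close>

definition of_iter1 :: "complex poly \<Rightarrow> S" where
  "of_iter1 P = poly (map_poly Const P) (var 1)"

definition of_iter2 :: "complex poly poly \<Rightarrow> S" where
  "of_iter2 P = poly (map_poly of_iter1 P) (var 2)"

definition of_iter3 :: "complex poly poly poly \<Rightarrow> S" where
  "of_iter3 P = poly (map_poly of_iter2 P) (var 3)"

definition of_iter :: "complex poly poly poly poly \<Rightarrow> S" where
  "of_iter P = poly (map_poly of_iter3 P) (var 4)"

lemma iter_const_hom: "ring_map (\<lambda>c::complex. [:[:[:[:c:]:]:]:])"
  by (intro ring_map_poly_const_hom ring_map_id)

lemma ring_map_to_iter: "ring_map to_iter"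
  unfolding to_iter_def by (rule ring_map_subst[OF iter_const_hom])

lemma to_iter_Const: "to_iter (Const c) = [:[:[:[:c:]:]:]:]"
  unfolding to_iter_def by (rule subst_Const[OF iter_const_hom])

lemma to_iter_var: "to_iter (var i) = (if i = 1 then [:[:[:[:0, 1:]:]:]:] else if i = 2 then [:[:[:0, 1:]:]:]
    else if i = 3 then [:[:0, 1:]:] else [:0, 1:])"
  unfolding to_iter_def by (rule subst_var[OF iter_const_hom])

lemma ring_map_of_iter1: "ring_map of_iter1"
  using ring_map_poly[OF ring_map_Const, of "var 1"] by (simp add: of_iter1_def[abs_def])

lemma ring_map_of_iter2: "ring_map of_iter2"
  using ring_map_poly[OF ring_map_of_iter1, of "var 2"] by (simp add: of_iter2_def[abs_def])

lemma ring_map_of_iter3: "ring_map of_iter3"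
  using ring_map_poly[OF ring_map_of_iter2, of "var 3"] by (simp add: of_iter3_def[abs_def])

lemma ring_map_of_iter: "ring_map of_iter"
  using ring_map_poly[OF ring_map_of_iter3, of "var 4"] by (simp add: of_iter_def[abs_def])

lemmas of_iter_consts =
  ring_map_poly_Const[OF ring_map_Const, of _ "var 1", folded of_iter1_def]
  ring_map_poly_Const[OF ring_map_of_iter1, of _ "var 2", folded of_iter2_def]
  ring_map_poly_Const[OF ring_map_of_iter2, of _ "var 3", folded of_iter3_def]
  ring_map_poly_Const[OF ring_map_of_iter3, of _ "var 4", folded of_iter_def]

lemmas of_iter_Xs =
  ring_map_poly_X[OF ring_map_Const, of "var 1", folded of_iter1_def]
  ring_map_poly_X[OF ring_map_of_iter1, of "var 2", folded of_iter2_def]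
  ring_map_poly_X[OF ring_map_of_iter2, of "var 3", folded of_iter3_def]
  ring_map_poly_X[OF ring_map_of_iter3, of "var 4", folded of_iter_def]

lemma of_iter_to_iter: "of_iter (to_iter g) = g"
proof (rule ring_map_S_eqI[OF ring_map_comp[OF ring_map_of_iter ring_map_to_iter] ring_map_id])
  show "of_iter (to_iter (Const c)) = Const c" for c
    by (simp only: to_iter_Const of_iter_consts)
  have "\<forall>i. of_iter (to_iter (var i)) = var i"
    unfolding forall_4 by (simp add: to_iter_var of_iter_consts of_iter_Xs distinct_4 distinct_4[symmetric])
  then show "of_iter (to_iter (var i)) = var i" for i by blast
qed

lemma to_iter_of_iter: "to_iter (of_iter P) = P"
proof -
  note comp = ring_map_comp[OF ring_map_to_iter]
  \<comment> \<open>On the polynomials in the first variables the composite is the embedding as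
    constants of the outer layers; each layer follows from the previous one.\<close>
  have 1: "to_iter (of_iter1 P) = [:[:[:P:]:]:]" for P
    by (rule ring_map_poly_eqI[OF comp[OF ring_map_of_iter1]])
       (simp_all add: of_iter_consts of_iter_Xs to_iter_Const to_iter_var ring_map_poly_const_hom ring_map_id)
  have 2: "to_iter (of_iter2 P) = [:[:P:]:]" for P
    by (rule ring_map_poly_eqI[OF comp[OF ring_map_of_iter2]])
       (simp_all add: of_iter_consts of_iter_Xs 1 to_iter_var ring_map_poly_const_hom ring_map_id distinct_4[symmetric])
  have 3: "to_iter (of_iter3 P) = [:P:]" for P
    by (rule ring_map_poly_eqI[OF comp[OF ring_map_of_iter3]])
       (simp_all add: of_iter_consts of_iter_Xs 2 to_iter_var ring_map_poly_const_hom ring_map_id distinct_4[symmetric])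
  show ?thesis
    by (rule ring_map_poly_eqI[OF comp[OF ring_map_of_iter] ring_map_id])
       (simp_all add: of_iter_consts of_iter_Xs 3 to_iter_var distinct_4[symmetric])
qed

text \<open>Divide by the gcd. Coprimality of the cofactors is stated as a cancellation rule, which
  carries over to \<open>S\<close> along the isomorphism.\<close>

lemma coprime_factorization:
  fixes u v :: S
  assumes "u \<noteq> 0"
  obtains g u' v' where "u = g * u'" "v = g * v'" "\<And>w. u' dvd v' * w \<Longrightarrow> u' dvd w"
proof -
  note tD = ring_mapD[OF ring_map_to_iter] and oD = ring_mapD[OF ring_map_of_iter]
  let ?g = "gcd (to_iter u) (to_iter v)"
  have "to_iter u \<noteq> 0" using assms of_iter_to_iter oD(1) by metis
  then have "?g \<noteq> 0" by simp
  then obtain a b where ab: "to_iter u = a * ?g" "to_iter v = b * ?g" "coprime a b"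
    using gcd_coprime_exists by blast
  show thesis
  proof (rule that)
    show "u = of_iter ?g * of_iter a"
      using arg_cong[OF ab(1), of of_iter] by (simp only: of_iter_to_iter oD(4) mult.commute)
    show "v = of_iter ?g * of_iter b"
      using arg_cong[OF ab(2), of of_iter] by (simp only: of_iter_to_iter oD(4) mult.commute)
    fix w assume "of_iter a dvd of_iter b * w"
    then obtain k where "of_iter b * w = of_iter a * k" by (rule dvdE)
    then have "to_iter (of_iter b * w) = to_iter (of_iter a * k)" by simp
    then have "b * to_iter w = a * to_iter k" by (simp only: tD(4) to_iter_of_iter)
    then have "a dvd b * to_iter w" by simp
    then have "a dvd to_iter w" using ab(3) by (simp add: coprime_dvd_mult_right_iff)
    then obtain z where "to_iter w = a * z" by (rule dvdE)
    then have "of_iter (to_iter w) = of_iter (a * z)" by simp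
    then have "w = of_iter a * of_iter z" by (simp only: of_iter_to_iter oD(4))
    then show "of_iter a dvd w" by simp
  qed
qed

text \<open>The common ratio of \<open>b\<close> to \<open>a\<close> is a fraction
  \<open>v / u\<close> in lowest terms. From \<open>u * b $ i = v * a $ i\<close> it follows that
  \<open>u\<close> divides every coordinate of \<open>a\<close>, and the quotient is
  \<open>c\<close>.\<close>

lemma proportional_vectors:
  fixes a b :: "S ^ 4"
  assumes "a \<noteq> 0" "\<And>i j. a $ i * b $ j = a $ j * b $ i"
  obtains c u v where "a = u *s c" "b = v *s c"
proof -
  obtain j where j: "a $ j \<noteq> 0" using assms(1) by (auto simp: vec_eq_iff)
  obtain g u v where g: "a $ j = g * u" "b $ j = g * v" and cop: "\<And>w. u dvd v * w \<Longrightarrow> u dvd w"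
    using coprime_factorization[OF j, of "b $ j"] by blast
  have "g \<noteq> 0" "u \<noteq> 0" using j g by auto
  have eq: "u * b $ i = v * a $ i" for i
  proof -
    have "g * (u * b $ i) = g * (v * a $ i)"
      using assms(2)[of j i] g by (simp add: mult.assoc mult.left_commute mult.commute)
    then show ?thesis using \<open>g \<noteq> 0\<close> by simp
  qed
  have "u dvd a $ i" for i using cop[of "a $ i"] eq[of i] by (metis dvd_triv_left)
  then obtain c where c: "\<And>i. a $ i = u * c i" unfolding dvd_def by metis
  show thesis
  proof (rule that)
    show "a = u *s (\<chi> i. c i)" by (simp add: vec_eq_iff c)
    have "b $ i = v * c i" for i
    proof -
      have "u * b $ i = u * (v * c i)" using eq[of i] c[of i] by (simp add: mult.left_commute)
      then show ?thesis using \<open>u \<noteq> 0\<close> by simp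
    qed
    then show "b = v *s (\<chi> i. c i)" by (simp add: vec_eq_iff)
  qed
qed

subsection \<open>Syzygies of lowest degree\<close>

definition hom_part_vec :: "nat \<Rightarrow> S ^ 4 \<Rightarrow> S ^ 4" where
  "hom_part_vec k a = (\<chi> i. hom_part k (a $ i))"

lemma hom_part_vec_add: "hom_part_vec k (a + b) = hom_part_vec k a + hom_part_vec k b"
  by (simp add: hom_part_vec_def vec_eq_iff hom_part_add)

lemma hom_part_vec_zero [simp]: "hom_part_vec k 0 = 0"
  by (simp add: hom_part_vec_def vec_eq_iff)

lemma hom_part_vec_scale: "hom_part_vec k (u *s c) = (\<Sum>j\<le>k. hom_part j u *s hom_part_vec (k - j) c)"
  by (simp add: hom_part_vec_def vec_eq_iff hom_part_mult)

lemma hom_part_vec_homogeneous: "homogeneous_vec e a \<Longrightarrow> hom_part_vec k a = (if k = e then a else 0)"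
  using hom_part_homogeneous[of e _ k] by (auto simp: homogeneous_vec_def hom_part_vec_def vec_eq_iff)

lemma sum_hom_part_vec: obtains D where "a = (\<Sum>k\<le>D. hom_part_vec k a)"
proof -
  have "\<forall>i. \<exists>D. \<forall>k>D. hom_part k (a $ i) = 0" using hom_part_eventually_zero by metis
  then obtain D where D: "\<And>i k. k > D i \<Longrightarrow> hom_part k (a $ i) = 0" by metis
  let ?D = "Max (range D)"
  have "a $ i = (\<Sum>k\<le>?D. hom_part k (a $ i))" for i
  proof -
    obtain E where E: "a $ i = (\<Sum>k\<le>E. hom_part k (a $ i))" using sum_hom_part by blast
    have le: "D i \<le> ?D" by (rule Max_ge) auto
    have "(\<Sum>k\<le>?D. hom_part k (a $ i)) = (\<Sum>k\<le>max E ?D. hom_part k (a $ i))"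
    proof (rule sum.mono_neutral_left)
      show "\<forall>k\<in>{..max E ?D} - {..?D}. hom_part k (a $ i) = 0"
      proof
        fix k assume "k \<in> {..max E ?D} - {..?D}"
        then have "\<not> k \<le> ?D" by simp
        with le have "D i < k" by linarith
        then show "hom_part k (a $ i) = 0" by (rule D)
      qed
    qed auto
    also have "\<dots> = (\<Sum>k\<le>E. hom_part k (a $ i))"
    proof (rule sum.mono_neutral_right)
      have "hom_part k (a $ i) = 0" if "k > E" for k
        using arg_cong[OF E, of "hom_part k"] that
        by (simp add: hom_part_sum hom_part_homogeneous[OF homogeneous_hom_part])
      then show "\<forall>k\<in>{..max E ?D} - {..E}. hom_part k (a $ i) = 0" by simp
    qed auto
    finally show ?thesis using E by simp
  qed
  then have "a = (\<Sum>k\<le>?D. hom_part_vec k a)" by (simp add: vec_eq_iff hom_part_vec_def)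
  then show thesis by (rule that)
qed

text \<open>The quotient of \<open>S ^ 4\<close> by the syzygies embeds into the domain
  \<open>S\<close>, so it is torsion-free.\<close>

lemma AR_cancel:
  assumes "u *s c \<in> AR f" "u \<noteq> 0" shows "c \<in> AR f"
proof -
  have "u * (\<Sum>i\<in>UNIV. c $ i * pd i f) = (\<Sum>i\<in>UNIV. (u *s c) $ i * pd i f)"
    by (simp add: sum_distrib_left mult.assoc)
  then show ?thesis using assms by (simp add: AR_def)
qed

lemma hom_part_vec_span_eq_0:
  assumes R: "\<And>r. r \<in> R \<Longrightarrow> \<exists>e\<ge>d. homogeneous_vec e r" and a: "a \<in> S4.span R" and k: "k < d"
  shows "hom_part_vec k a = 0"
proof -
  have "\<forall>k<d. hom_part_vec k a = 0"
    using a
  proof (induction a rule: S4.span_induct_alt)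
    case base show ?case by simp
  next
    case (step c x y)
    obtain e where "e \<ge> d" "homogeneous_vec e x" using R step(1) by blast
    then have "hom_part_vec j x = 0" if "j < d" for j using that by (simp add: hom_part_vec_homogeneous)
    then show ?case using step by (simp add: hom_part_vec_add hom_part_vec_scale)
  qed
  then show ?thesis using k by blast
qed

lemma homogeneous_0_eq_Const: "homogeneous 0 g \<Longrightarrow> g = Const (Poly_Mapping.lookup g 0)"
proof (rule poly_mapping_eqI)
  fix m assume g: "homogeneous 0 g"
  have "Poly_Mapping.lookup g m = 0" if "m \<noteq> 0"
  proof -
    have "mdeg m \<noteq> 0"
    proof
      assume "mdeg m = 0"
      then have "\<forall>i. Poly_Mapping.lookup m i = 0" by (simp add: mdeg_def)
      then show False using that by (simp add: poly_mapping_eq_iff fun_eq_iff)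
    qed
    then have "m \<notin> Poly_Mapping.keys g" using g unfolding homogeneous_def by auto
    then show ?thesis by (simp add: in_keys_iff)
  qed
  then show "Poly_Mapping.lookup g m = Poly_Mapping.lookup (Const (Poly_Mapping.lookup g 0)) m"
    by (simp add: lookup_single when_def)
qed

text \<open>Here \<open>a\<close> generates the lowest degree \<open>d\<close>, so the constant term of \<open>u\<close> is a unit, and the components of \<open>c\<close>
  can be solved for recursively from those of \<open>u *s c = a\<close>.\<close>

lemma quotient_in_span:
  assumes a: "homogeneous_vec d a" "a \<noteq> 0" "a = u *s c"
    and low: "\<And>k. k < d \<Longrightarrow> hom_part_vec k c = 0"
  shows "c \<in> S4.span {a}"
proof -
  \<comment> \<open>As \<open>c\<close> has no components below degree \<open>d\<close>, only the
    constant term of \<open>u\<close> contributes in degree \<open>d\<close>.\<close>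
  have "hom_part_vec d a = (\<Sum>j\<le>d. if j = 0 then hom_part 0 u *s hom_part_vec d c else 0)"
    unfolding a(3) hom_part_vec_scale by (intro sum.cong) (auto simp: low)
  then have "a = hom_part 0 u *s hom_part_vec d c" using hom_part_vec_homogeneous[OF a(1), of d] by simp
  then have u0: "hom_part 0 u \<noteq> 0" using a(2) by auto
  define z where "z = Poly_Mapping.lookup (hom_part 0 u) 0"
  have z: "hom_part 0 u = Const z" unfolding z_def by (rule homogeneous_0_eq_Const[OF homogeneous_hom_part])
  then have z0: "z \<noteq> 0" using u0 by auto
  have comp: "hom_part_vec k c \<in> S4.span {a}" for k
  proof (induction k rule: less_induct)
    case (less k)
    have "hom_part_vec k a = Const z *s hom_part_vec k c + (\<Sum>j\<in>{1..k}. hom_part j u *s hom_part_vec (k - j) c)"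
      unfolding a(3) hom_part_vec_scale atMost_atLeast0 by (subst sum.atLeast_Suc_atMost) (simp_all add: z)
    then have "Const z *s hom_part_vec k c = hom_part_vec k a - (\<Sum>j\<in>{1..k}. hom_part j u *s hom_part_vec (k - j) c)" by simp
    moreover have "hom_part_vec k a \<in> S4.span {a}"
      using hom_part_vec_homogeneous[OF a(1), of k] by (auto intro: S4.span_base S4.span_zero)
    moreover have "(\<Sum>j\<in>{1..k}. hom_part j u *s hom_part_vec (k - j) c) \<in> S4.span {a}"
      by (intro S4.span_sum S4.span_scale less) auto
    ultimately have "Const z *s hom_part_vec k c \<in> S4.span {a}" by (simp add: S4.span_diff)
    then have "Const (inverse z) *s (Const z *s hom_part_vec k c) \<in> S4.span {a}" by (rule S4.span_scale)
    then show ?case using z0 by (simp add: mult_single)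
  qed
  obtain D where D: "c = (\<Sum>k\<le>D. hom_part_vec k c)" by (rule sum_hom_part_vec)
  have "(\<Sum>k\<le>D. hom_part_vec k c) \<in> S4.span {a}" by (intro S4.span_sum comp)
  then show ?thesis using D by simp
qed

section \<open>Minimal generators and the bounds on their degrees\<close>

lemma minimal_not_in_span:
  assumes "minimal_generating_set M R" "r \<in> R" shows "r \<notin> S4.span (R - {r})"
proof
  assume "r \<in> S4.span (R - {r})"
  then have "insert r (R - {r}) \<subseteq> S4.span (R - {r})" by (auto intro: S4.span_base)
  then have "S4.span (insert r (R - {r})) = S4.span (R - {r})"
    by (intro subset_antisym S4.span_minimal S4.subspace_span S4.span_mono) auto
  moreover have "insert r (R - {r}) = R" using assms(2) by blast
  ultimately have "S4.span (R - {r}) = M" using assms(1) by (simp add: minimal_generating_set_def)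
  then show False using assms by (auto simp: minimal_generating_set_def)
qed

text \<open>Each \<open>i\<close> other than \<open>j\<close> has a syzygy with
  \<open>pd j f\<close> in position \<open>i\<close> and \<open>- pd i f\<close> in position
  \<open>j\<close>. Without coordinate \<open>j\<close> these three form \<open>pd j f\<close> times
  the identity matrix, which cannot factor through two generators, as its determinant is a nonzero
  cube.\<close>

lemma rank_ge_3:
  assumes f: "pd j f \<noteq> 0" and R: "S4.span {r, s} = AR f"
  shows False
proof -
  let ?F = "\<lambda>i. pd i f"
  have "\<exists>k l m. j \<noteq> k \<and> j \<noteq> l \<and> j \<noteq> m \<and> k \<noteq> l \<and> k \<noteq> m \<and> l \<noteq> m"
    using exhaust_4[of j]
  proof (elim disjE)
    assume "j = 1" then show ?thesis by (intro exI[of _ 2] exI[of _ 3] exI[of _ 4]) simp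
  next
    assume "j = 2" then show ?thesis by (intro exI[of _ 1] exI[of _ 3] exI[of _ 4]) simp
  next
    assume "j = 3" then show ?thesis by (intro exI[of _ 1] exI[of _ 2] exI[of _ 4]) simp
  next
    assume "j = 4" then show ?thesis by (intro exI[of _ 1] exI[of _ 2] exI[of _ 3]) simp
  qed
  then obtain k l m where d: "j \<noteq> k" "j \<noteq> l" "j \<noteq> m" "k \<noteq> l" "k \<noteq> m" "l \<noteq> m" by blast
  have "\<exists>x y. \<forall>i'. i' \<noteq> j \<longrightarrow> x * r $ i' + y * s $ i' = (if i' = i then ?F j else 0)" if "i \<noteq> j" for i
  proof -
    define e :: "S ^ 4" where "e = (\<chi> i'. if i' = i then ?F j else if i' = j then - ?F i else 0)"
    have "(\<Sum>i'\<in>UNIV. e $ i' * ?F i') = (\<Sum>i'\<in>{i, j}. e $ i' * ?F i')"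
      by (intro sum.mono_neutral_right) (auto simp: e_def)
    also have "\<dots> = 0" using that by (simp add: e_def)
    finally have "e \<in> S4.span {r, s}" unfolding R AR_def by simp
    then obtain x where "e - x *s r \<in> S4.span {s}" by (auto simp: S4.span_insert)
    then obtain y where "e - x *s r = y *s s" by (auto simp: S4.span_singleton)
    then have "e = x *s r + y *s s" by (simp add: algebra_simps)
    then have "x * r $ i' + y * s $ i' = e $ i'" for i' by simp
    then show ?thesis by (intro exI[of _ x] exI[of _ y]) (simp add: e_def)
  qed
  then have "\<forall>i. \<exists>x y. i \<noteq> j \<longrightarrow> (\<forall>i'. i' \<noteq> j \<longrightarrow> x * r $ i' + y * s $ i' = (if i' = i then ?F j else 0))"
    by blast
  then obtain x y where "\<forall>i. i \<noteq> j \<longrightarrow> (\<forall>i'. i' \<noteq> j \<longrightarrow> x i * r $ i' + y i * s $ i' = (if i' = i then ?F j else 0))"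
    unfolding choice_iff by blast
  then have xy: "x i * r $ i' + y i * s $ i' = (if i' = i then ?F j else 0)" if "i \<noteq> j" "i' \<noteq> j" for i i'
    using that by blast
  let ?m = "\<lambda>i i'. x i * r $ i' + y i * s $ i'"
  \<comment> \<open>The determinant of a product of a 3 by 2 and a 2 by 3 matrix vanishes
    identically.\<close>
  have "?m k k * (?m l l * ?m m m - ?m l m * ?m m l) - ?m k l * (?m l k * ?m m m - ?m l m * ?m m k)
      + ?m k m * (?m l k * ?m m l - ?m l l * ?m m k) = 0"
    by (simp add: algebra_simps)
  then have "?F j * (?F j * ?F j) = 0"
    using d by (simp add: xy)
  then show False using f by simp
qed

text \<open>If the bound failed, \<open>a\<close> and \<open>b\<close> would be multiples of one
  vector \<open>c\<close>, itself a syzygy by torsion-freeness. By \<open>low\<close> no syzygy has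
  components below degree \<open>k\<close>, so \<open>c\<close> and therefore \<open>b\<close> would
  be multiples of \<open>a\<close>.\<close>

lemma first_two_exponents:
  assumes f: "homogeneous d f" and "at_most_isolated_singularities f"
    and min: "minimal_generating_set (AR f) R"
    and a: "a \<in> R" "homogeneous_vec k a" and b: "b \<in> R" "homogeneous_vec m b" and "a \<noteq> b"
    and low: "\<And>r. r \<in> R \<Longrightarrow> \<exists>e\<ge>k. homogeneous_vec e r"
  shows "d - 1 \<le> k + m"
proof (rule ccontr)
  assume "\<not> d - 1 \<le> k + m"
  then have less: "k + m < d - 1" by simp
  have F: "homogeneous (d - 1) (pd i f)" for i by (rule homogeneous_pd[OF f])
  have fin: "finite {vec.span {p} | p. p \<noteq> 0 \<and> (\<forall>i. eval_at p (pd i f) = 0)}"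
    using assms(2) by (simp add: at_most_isolated_singularities_def singular_points_def)
  obtain g h q where reg: "regular_triple (\<Sum>i\<in>UNIV. g i * pd i f) (\<Sum>i\<in>UNIV. h i * pd i f) (\<Sum>i\<in>UNIV. q i * pd i f)"
    by (rule regular_triple_in_ideal[of "d - 1" "\<lambda>i. pd i f", OF F fin])
  have span: "S4.span R = AR f" using min by (simp add: minimal_generating_set_def)
  have aA: "a \<in> AR f" and bA: "b \<in> AR f" using a(1) b(1) span S4.span_base by blast+
  have a0: "a \<noteq> 0" using minimal_not_in_span[OF min a(1)] S4.span_zero by auto
  have "a $ i * b $ j = a $ j * b $ i" for i j
    by (rule syzygies_proportional[OF reg refl refl refl F _ _ _ _ less])
       (use aA bA a(2) b(2) in \<open>simp_all add: AR_def homogeneous_vec_def\<close>)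
  then obtain c u v where c: "a = u *s c" "b = v *s c" using proportional_vectors[OF a0] by blast
  then have "c \<in> AR f" using aA a0 AR_cancel[of u c f] by auto
  then have "c \<in> S4.span R" using span by simp
  then have "hom_part_vec j c = 0" if "j < k" for j using hom_part_vec_span_eq_0[OF low _ that] by blast
  then have "c \<in> S4.span {a}" by (rule quotient_in_span[OF a(2) a0 c(1)])
  then have "b \<in> S4.span {a}" unfolding c(2) by (rule S4.span_scale)
  moreover have "{a} \<subseteq> R - {b}" using a(1) \<open>a \<noteq> b\<close> by blast
  ultimately have "b \<in> S4.span (R - {b})" using S4.span_mono by blast
  then show False using minimal_not_in_span[OF min b(1)] by blast
qed

lemma not_free:
  assumes f: "homogeneous d f" and "at_most_isolated_singularities f" and d: "d > 1"
  shows "\<not> free_surface f"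
proof
  assume "free_surface f"
  then obtain B where B: "S4.independent B" "S4.span B = {v. (\<Sum>i\<in>UNIV. v $ i * pd i f) = 0}"
    by (auto simp: free_surface_def free_module_def AR_def)
  have F: "homogeneous (d - 1) (pd i f)" for i by (rule homogeneous_pd[OF f])
  have fin: "finite {vec.span {p} | p. p \<noteq> 0 \<and> (\<forall>i. eval_at p (pd i f) = 0)}"
    using assms(2) by (simp add: at_most_isolated_singularities_def singular_points_def)
  obtain g h q where reg: "regular_triple (\<Sum>i\<in>UNIV. g i * pd i f) (\<Sum>i\<in>UNIV. h i * pd i f) (\<Sum>i\<in>UNIV. q i * pd i f)"
    by (rule regular_triple_in_ideal[of "d - 1" "\<lambda>i. pd i f", OF F fin])
  obtain e where "(\<Sum>i\<in>UNIV. e i * pd i f) = 1"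
    by (rule free_syzygies_imp_unit[OF reg refl refl refl B])
  \<comment> \<open>For \<open>d > 1\<close> the partial derivatives have positive degree, so no
    combination of them has a constant term.\<close>
  then have "hom_part 0 1 = (\<Sum>i\<in>UNIV. (if d - 1 \<le> 0 then hom_part (0 - (d - 1)) (e i) else 0) * pd i f)"
    using hom_part_combination[of "d - 1" "\<lambda>i. pd i f" 0 e, OF F] by simp
  then have "hom_part 0 1 = 0" using d by simp
  then show False using hom_part_homogeneous[OF homogeneous_one, of 0] by simp
qed

text \<open>The claim on the length ensures that \<open>ds ! 2\<close> is a genuine entry of the
  list.\<close>

theorem proposition4p1:
  fixes f :: S and d :: nat
  assumes "d \<ge> 1" and "f \<noteq> 0" and "homogeneous d f"
    and "at_most_isolated_singularities f"
  shows "(\<forall>ds. exponents f ds \<longrightarrow>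
            length ds \<ge> 3 \<and>
            surface_type d ds = int (ds ! 0) + int (ds ! 1) + int (ds ! 2) + 1 - int d \<and>
            surface_type d ds \<ge> int (ds ! 2) \<and>
            real (ds ! 2) \<ge> (real d - 1) / 2) \<and>
         (d > 1 \<longrightarrow> \<not> free_surface f)"
proof (intro conjI allI impI)
  show "\<not> free_surface f" if "d > 1" using not_free[OF assms(3,4) that] .
  fix ds assume "exponents f ds"
  then obtain rs where ds: "sorted ds" and rs: "distinct rs" "minimal_generating_set (AR f) (set rs)"
      "list_all2 homogeneous_vec ds rs"
    by (auto simp: exponents_def)
  have len: "length ds = length rs" using rs(3) by (rule list_all2_lengthD)
  obtain j where j: "pd j f \<noteq> 0" using pd_nonzero[OF assms(3,2,1)] by blast
  have span: "S4.span (set rs) = AR f" using rs(2) by (simp add: minimal_generating_set_def)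
  show l3: "length ds \<ge> 3"
  proof (rule ccontr)
    assume "\<not> length ds \<ge> 3"
    then have "length rs = 0 \<or> length rs = Suc 0 \<or> length rs = Suc (Suc 0)" using len by linarith
    \<comment> \<open>Fewer than two generators are padded by repetition or by 0.\<close>
    then have "\<exists>r s. S4.span {r, s} = S4.span (set rs)"
    proof (elim disjE)
      assume "length rs = 0"
      then have "S4.span {0, 0} = S4.span (set rs)" by (auto simp: S4.span_singleton)
      then show ?thesis by blast
    next
      assume "length rs = Suc 0"
      then obtain r where "rs = [r]" by (auto simp: length_Suc_conv)
      then show ?thesis by (intro exI[of _ r]) simp
    next
      assume "length rs = Suc (Suc 0)"
      then obtain r s where "rs = [r, s]" by (auto simp: length_Suc_conv)
      then show ?thesis by (intro exI[of _ r] exI[of _ s]) simp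
    qed
    then show False using rank_ge_3[OF j] span by blast
  qed
  have hom: "homogeneous_vec (ds ! i) (rs ! i)" if "i < length rs" for i
    using rs(3) that len by (simp add: list_all2_nthD2)
  have "d - 1 \<le> ds ! 0 + ds ! 1"
  proof (rule first_two_exponents[OF assms(3,4) rs(2)])
    show "rs ! 0 \<in> set rs" "rs ! 1 \<in> set rs" by (rule nth_mem, use l3 len in linarith)+
    show "homogeneous_vec (ds ! 0) (rs ! 0)" "homogeneous_vec (ds ! 1) (rs ! 1)"
      by (rule hom, use l3 len in linarith)+
    show "rs ! 0 \<noteq> rs ! 1" 
    proof -
      have "0 < length rs" "1 < length rs" using l3 len by linarith+
      then show ?thesis using rs(1) by (simp add: nth_eq_iff_index_eq)
    qed
    fix r assume "r \<in> set rs"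
    then obtain i where "i < length rs" "r = rs ! i" by (auto simp: in_set_conv_nth)
    then show "\<exists>e\<ge>ds ! 0. homogeneous_vec e r"
      using hom[of i] len sorted_nth_mono[OF ds, of 0 i] by auto
  qed
  \<comment> \<open>The third exponent dominates the first two, so twice it is at least their sum,
    hence at least \<open>d - 1\<close>.\<close>
  moreover have "ds ! 0 \<le> ds ! 2" "ds ! 1 \<le> ds ! 2"
    using l3 by (auto intro: sorted_nth_mono[OF ds])
  ultimately show "surface_type d ds = int (ds ! 0) + int (ds ! 1) + int (ds ! 2) + 1 - int d"
    "surface_type d ds \<ge> int (ds ! 2)" "real (ds ! 2) \<ge> (real d - 1) / 2"
    by (simp_all add: surface_type_def)
qed

end
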